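(* Let $n\geq 1$, $\underline x=(x_1,\ldots,x_n)$, let $R=K$ be a field, and let $\underline P=\{P_1,\ldots,P_s\}$ ($s\geq 1$) be a set of polynomials irreducible in $R[\underline x,y]$ and of degree $\geq 1$ in $y$. Let $\mathcal{I}rr_n(R,\underline P)$ be the set of $M\in R[\underline x]$ such that $P_1(\underline x,M(\underline x)),\ldots,P_s(\underline x,M(\underline x))$ are all irreducible in $R[\underline x]$. Then $\mathcal{I}rr_n(R,\underline P)$ is Zariski-dense in $\mathcal{P}ol_{R,n,\underline d}$ for every $n$-tuple $\underline d=(d_1,\ldots,d_n)$ of positive integers, in each of these two situations: (a) $R=K$ is a totally Hilbertian field; (b) $R=K$ is a Hilbertian field and $\deg_y(P_1)=\cdots=\deg_y(P_s)=1$.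
   Context: Hilbert subsets: let $K$ be a field, $\underline\lambda=(\lambda_1,\ldots,\lambda_r)$ and $\underline x=(x_1,\ldots,x_n)$ tuples of indeterminates ($r,n\geq1$). Given $f_1,\ldots,f_m$ ($m\geq 1$) irreducible in $K(\underline\lambda)[\underline x]$ and a nonzero $g\in K[\underline\lambda]$, the set $H_K(f_1,\ldots,f_m;g)$ of all $\underline\lambda^\ast\in K^r$ such that $f_i(\underline\lambda^\ast,\underline x)$ is (defined and) irreducible in $K[\underline x]$ for each $i$ and $g(\underline\lambda^\ast)\neq0$ is called a Hilbert subset of $K^r$. If in addition $n=1$ and each $f_i$ is separable in $x$ (no multiple root in $\overline{K(\underline\lambda)}$), it is called a separable Hilbert subset of $K^r$. $K$ is Hilbertian if every separable Hilbert subset of $K^r$ is nonempty for every $r\geq1$, and totally Hilbertian if every Hilbert subset of $K^r$ is nonempty for every $r\geq 1$. $\mathcal{P}ol_{R,n,\underline d}$ is the set of $M\in R[\underline x]$ with $\deg_{x_i}(M)\leq d_i$ for $i=1,\ldots,n$, identified via coefficients with the affine space $R^{N+1}$, $N+1=\prod_i(d_i+1)$. A set of polynomials is Zariski-dense in it if no nonzero polynomial in $N+1$ variables over $K$ vanishes on all coefficient tuples of its elements lying in $\mathcal{P}ol_{R,n,\underline d}$. *)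

theory Defs
  imports
    "HOL-Library.Poly_Mapping"
    "HOL-Library.FuncSet"
    "HOL-Computational_Algebra.Polynomial"
    "HOL-Computational_Algebra.Fraction_Field"
    "HOL-Algebra.Ring_Divisibility"
    "HOL-Algebra.Algebraic_Closure_Type"
begin

text \<open>
  The number of variables has to be quantified over inside the definition of a Hilbertian field,
  so it cannot be a type. Polynomials therefore live in types with variables indexed by all
  natural numbers, and rings such as \<open>K[x\<^sub>0, \<dots>, x\<^sub>n\<^sub>-\<^sub>1]\<close> or \<open>K(\<lambda>\<^sub>0, \<dots>, \<lambda>\<^sub>r\<^sub>-\<^sub>1)\<close> are subsets of
  these types. Irreducibility always refers to such a subring. The base field \<open>K\<close> is a type of
  class field.
\<close>

type_synonym ('v, 'a) mpoly = "('v \<Rightarrow>\<^sub>0 nat) \<Rightarrow>\<^sub>0 'a"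

definition mpolys :: "'v set \<Rightarrow> 'a set \<Rightarrow> ('v, 'a::zero) mpoly set" where
  "mpolys V A = {p. \<forall>m \<in> Poly_Mapping.keys p.
     Poly_Mapping.keys m \<subseteq> V \<and> Poly_Mapping.lookup p m \<in> A}"

abbreviation polys :: "nat \<Rightarrow> (nat, 'k::field) mpoly set" where
  "polys n \<equiv> mpolys {..<n} UNIV"

definition ratfuns :: "nat \<Rightarrow> (nat, 'k::field) mpoly fract set" where
  "ratfuns r = {Fract a b | a b. a \<in> polys r \<and> b \<in> polys r \<and> b \<noteq> 0}"

definition eval_mpoly :: "('v \<Rightarrow> 'a::comm_semiring_1) \<Rightarrow> ('v, 'a) mpoly \<Rightarrow> 'a" where
  "eval_mpoly t p = (\<Sum>m \<in> Poly_Mapping.keys p.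
     Poly_Mapping.lookup p m * (\<Prod>v \<in> Poly_Mapping.keys m. t v ^ Poly_Mapping.lookup m v))"

definition irreducible_in :: "'a::comm_ring_1 set \<Rightarrow> 'a \<Rightarrow> bool" where
  "irreducible_in A p \<longleftrightarrow>
     p \<in> A \<and> ring_irreducible\<^bsub>ring_of_type_algebra\<lparr>carrier := A\<rparr>\<^esub> p"

text \<open>
  \<open>q\<close> is the polynomial \<open>f(t, x)\<close> over \<open>K\<close>: every coefficient of \<open>f\<close>, a rational function in
  \<open>r\<close> variables, is defined at \<open>t\<close>, and the coefficients of \<open>q\<close> are the values. Such a \<open>q\<close>
  exists iff \<open>f(t, x)\<close> is defined, and it is then unique.
\<close>

definition is_specialization ::
    "nat \<Rightarrow> (nat \<Rightarrow> 'k::field) \<Rightarrow> (nat, (nat, 'k) mpoly fract) mpoly \<Rightarrow> (nat, 'k) mpoly \<Rightarrow> bool" where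
  "is_specialization r t f q \<longleftrightarrow>
     (\<forall>m. \<exists>a \<in> polys r. \<exists>b \<in> polys r. eval_mpoly t b \<noteq> 0 \<and>
        Poly_Mapping.lookup f m = Fract a b \<and>
        Poly_Mapping.lookup q m = eval_mpoly t a / eval_mpoly t b)"

definition hilbert_set ::
    "nat \<Rightarrow> nat \<Rightarrow> (nat, (nat, 'k::field) mpoly fract) mpoly set \<Rightarrow> (nat, 'k) mpoly \<Rightarrow>
     (nat \<Rightarrow> 'k) set" where
  "hilbert_set r n F g = {t \<in> {..<r} \<rightarrow>\<^sub>E UNIV.
     (\<forall>f \<in> F. \<exists>q. is_specialization r t f q \<and> irreducible_in (polys n) q) \<and>
     eval_mpoly t g \<noteq> 0}"

definition hilbert_data ::
    "nat \<Rightarrow> nat \<Rightarrow> (nat, (nat, 'k::field) mpoly fract) mpoly set \<Rightarrow> (nat, 'k) mpoly \<Rightarrow> bool" where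
  "hilbert_data r n F g \<longleftrightarrow>
     finite F \<and> F \<noteq> {} \<and> (\<forall>f \<in> F. irreducible_in (mpolys {..<n} (ratfuns r)) f) \<and>
     g \<in> polys r \<and> g \<noteq> 0"

definition hilbert_subset :: "nat \<Rightarrow> (nat \<Rightarrow> 'k::field) set \<Rightarrow> bool" where
  "hilbert_subset r H \<longleftrightarrow> (\<exists>n F g. n \<ge> 1 \<and> hilbert_data r n F g \<and> H = hilbert_set r n F g)"

definition upoly :: "(nat, 'a::comm_monoid_add) mpoly \<Rightarrow> 'a poly" where
  "upoly f = (\<Sum>m \<in> Poly_Mapping.keys f.
     Polynomial.monom (Poly_Mapping.lookup f m) (Poly_Mapping.lookup m 0))"

text \<open>
  For \<open>f\<close> in \<open>K(\<lambda>\<^sub>0, \<dots>, \<lambda>\<^sub>r\<^sub>-\<^sub>1)[x\<^sub>0]\<close>. The algebraic closure of the ambient field of rational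
  functions in all variables contains one of \<open>K(\<lambda>\<^sub>0, \<dots>, \<lambda>\<^sub>r\<^sub>-\<^sub>1)\<close>, where all roots of \<open>f\<close> lie.
\<close>

definition separable_poly :: "(nat, (nat, 'k::field) mpoly fract) mpoly \<Rightarrow> bool" where
  "separable_poly f \<longleftrightarrow>
     \<not> (\<exists>z :: (nat, 'k) mpoly fract alg_closure. order z (map_poly to_ac (upoly f)) \<ge> 2)"

definition separable_hilbert_subset :: "nat \<Rightarrow> (nat \<Rightarrow> 'k::field) set \<Rightarrow> bool" where
  "separable_hilbert_subset r H \<longleftrightarrow>
     (\<exists>F g. hilbert_data r 1 F g \<and> (\<forall>f \<in> F. separable_poly f) \<and> H = hilbert_set r 1 F g)"

definition hilbertian :: "'k::field itself \<Rightarrow> bool" where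
  "hilbertian _ \<longleftrightarrow>
     (\<forall>r \<ge> 1. \<forall>H :: (nat \<Rightarrow> 'k) set. separable_hilbert_subset r H \<longrightarrow> H \<noteq> {})"

definition totally_hilbertian :: "'k::field itself \<Rightarrow> bool" where
  "totally_hilbertian _ \<longleftrightarrow>
     (\<forall>r \<ge> 1. \<forall>H :: (nat \<Rightarrow> 'k) set. hilbert_subset r H \<longrightarrow> H \<noteq> {})"

text \<open>\<open>K[x, y]\<close> is \<open>K[x][y]\<close>, so that \<open>degree P\<close> is the degree in \<open>y\<close> and \<open>poly P M\<close> is \<open>P(x, M(x))\<close>.\<close>

definition polys_y :: "nat \<Rightarrow> (nat, 'k::field) mpoly poly set" where
  "polys_y n = {P. \<forall>i. Polynomial.coeff P i \<in> polys n}"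

definition Irr :: "nat \<Rightarrow> (nat, 'k::field) mpoly poly set \<Rightarrow> (nat, 'k) mpoly set" where
  "Irr n Ps = {M \<in> polys n. \<forall>P \<in> Ps. irreducible_in (polys n) (poly P M)}"

definition deg_in :: "'v \<Rightarrow> ('v, 'a::zero) mpoly \<Rightarrow> nat" where
  "deg_in v p = Max (insert 0 ((\<lambda>m. Poly_Mapping.lookup m v) ` Poly_Mapping.keys p))"

definition Pol :: "nat \<Rightarrow> (nat \<Rightarrow> nat) \<Rightarrow> (nat, 'k::field) mpoly set" where
  "Pol n d = {M \<in> polys n. \<forall>i < n. deg_in i M \<le> d i}"

text \<open>
  The coordinates of the affine space of coefficient tuples are indexed by the
  \<open>(d\<^sub>0 + 1) \<cdots> (d\<^sub>n\<^sub>-\<^sub>1 + 1)\<close> monomials themselves.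
\<close>

definition exponents :: "nat \<Rightarrow> (nat \<Rightarrow> nat) \<Rightarrow> (nat \<Rightarrow>\<^sub>0 nat) set" where
  "exponents n d = {m. Poly_Mapping.keys m \<subseteq> {..<n} \<and> (\<forall>i < n. Poly_Mapping.lookup m i \<le> d i)}"

definition zariski_dense_in_Pol ::
    "nat \<Rightarrow> (nat \<Rightarrow> nat) \<Rightarrow> (nat, 'k::field) mpoly set \<Rightarrow> bool" where
  "zariski_dense_in_Pol n d Z \<longleftrightarrow>
     \<not> (\<exists>H :: (nat \<Rightarrow>\<^sub>0 nat, 'k) mpoly. H \<in> mpolys (exponents n d) UNIV \<and> H \<noteq> 0 \<and>
          (\<forall>M \<in> Z \<inter> Pol n d. eval_mpoly (Poly_Mapping.lookup M) H = 0))"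

end

theory Submission
  imports Defs
begin

text \<open>
  Write \<open>M = \<Sum>\<^sub>m \<lambda>\<^sub>m x\<^sup>m\<close> with indeterminate coefficients. The shear of the constant coefficient
  \<open>\<lambda>\<^sub>0\<close> by the other terms is an automorphism of \<open>K[\<lambda>, x]\<close> that takes \<open>P(x, \<lambda>\<^sub>0)\<close> to \<open>P(x, M)\<close>, so
  the latter is irreducible, and it remains so over \<open>K(\<lambda>)\<close> by Gauss's lemma. For totally Hilbertian
  \<open>K\<close> one specializes \<open>\<lambda>\<close>, keeping \<open>g(\<lambda>) \<noteq> 0\<close> for a given hypersurface \<open>g = 0\<close>.

  For Hilbertian \<open>K\<close> one also treats \<open>x\<^sub>1, \<dots>, x\<^sub>n\<^sub>-\<^sub>1\<close> as parameters. If \<open>P\<close> is linear in \<open>y\<close> then \<open>P(x, M)\<close> is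
  separable in \<open>x\<^sub>0\<close>. After the substitution \<open>x\<^sub>i \<mapsto> x\<^sub>i + x\<^sub>0 ^ (B ^ i)\<close> the leading coefficient in \<open>x\<^sub>0\<close> of the
  specialized polynomial, and hence of each of its factors, is a constant, so that a nontrivial
  factorization would survive the specialization of \<open>x\<^sub>1, \<dots>, x\<^sub>n\<^sub>-\<^sub>1\<close>.
\<close>

subsection \<open>Subrings, units and irreducible elements\<close>

text \<open>Irreducibility is relative to a subset of an ambient type, so factoriality is developed
  for subsets as well. Irreducibility over \<open>K[\<lambda>]\<close> passes to
  \<open>K(\<lambda>)\<close> only if the polynomial does not become a unit there. This is excluded
  by showing that it divides no nonzero polynomial in the parameters, even when all variables but
  x_0 count as parameters. They have to count as parameters in the Hilbertian case because separable
  Hilbert subsets allow a single unknown. The point obtained then fixes x_1, ..., x_{n-1} too, and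
  irreducibility on one line says nothing about a factor that becomes constant on it. The shift that
  prevents this has to be built into the generic polynomial before any point is chosen, so
  \<open>B\<close> must bound the exponents of P(x, M) for all M at once; a bound in terms of the P
  and d exists. Linearity in y serves separability: if K has characteristic p and a is not a p-th
  power, then y^p - a is irreducible, but M^p - a has zero derivative in every variable for every
  M.\<close>

definition subring_set :: "'a::comm_ring_1 set \<Rightarrow> bool" where
  "subring_set A \<longleftrightarrow> 0 \<in> A \<and> 1 \<in> A \<and> (\<forall>a \<in> A. \<forall>b \<in> A. a + b \<in> A \<and> a * b \<in> A) \<and> (\<forall>a \<in> A. - a \<in> A)"

lemma
  assumes "subring_set A"
  shows subring_zero: "0 \<in> A" and subring_one: "1 \<in> A"
    and subring_add: "a \<in> A \<Longrightarrow> b \<in> A \<Longrightarrow> a + b \<in> A"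
    and subring_mult: "a \<in> A \<Longrightarrow> b \<in> A \<Longrightarrow> a * b \<in> A"
    and subring_uminus: "a \<in> A \<Longrightarrow> - a \<in> A"
    and subring_diff: "a \<in> A \<Longrightarrow> b \<in> A \<Longrightarrow> a - b \<in> A"
  using assms by (auto simp: subring_set_def) (metis diff_conv_add_uminus)

lemma subring_sum: "subring_set A \<Longrightarrow> (\<And>i. i \<in> I \<Longrightarrow> f i \<in> A) \<Longrightarrow> sum f I \<in> A"
  by (induction I rule: infinite_finite_induct) (auto intro: subring_zero subring_add)

lemma subring_prod: "subring_set A \<Longrightarrow> (\<And>i. i \<in> I \<Longrightarrow> f i \<in> A) \<Longrightarrow> prod f I \<in> A"
  by (induction I rule: infinite_finite_induct) (auto intro: subring_one subring_mult)

lemma subring_power: "subring_set A \<Longrightarrow> a \<in> A \<Longrightarrow> a ^ k \<in> A"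
  by (induction k) (auto intro: subring_one subring_mult)

definition unit_in :: "'a::comm_ring_1 set \<Rightarrow> 'a \<Rightarrow> bool" where
  "unit_in A a \<longleftrightarrow> a \<in> A \<and> (\<exists>b \<in> A. a * b = 1)"

lemma unit_in_multD:
  assumes "subring_set A" "unit_in A (a * b)" "a \<in> A" "b \<in> A"
  shows "unit_in A a" "unit_in A b"
proof -
  obtain c where "c \<in> A" "a * b * c = 1"
    using assms by (auto simp: unit_in_def)
  then have "a * (b * c) = 1" "b * (a * c) = 1" "b * c \<in> A" "a * c \<in> A"
    using assms by (auto simp: ac_simps intro: subring_mult)
  then show "unit_in A a" "unit_in A b"
    using assms by (auto simp: unit_in_def)
qed

text \<open>The library notion speaks of proper factors. In a domain, a factor \<open>a\<close> of
  \<open>p = a * b\<close> fails to be proper only if \<open>p\<close> divides \<open>a\<close>, and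
  cancelling \<open>a\<close> then makes \<open>b\<close> a unit.\<close>

lemma irreducible_in_iff:
  fixes A :: "'a::idom set"
  assumes A: "subring_set A"
  shows "irreducible_in A p \<longleftrightarrow> p \<in> A \<and> p \<noteq> 0 \<and> \<not> unit_in A p \<and>
    (\<forall>a \<in> A. \<forall>b \<in> A. p = a * b \<longrightarrow> unit_in A a \<or> unit_in A b)"
proof -
  let ?R = "ring_of_type_algebra\<lparr>carrier := A\<rparr>"
  have units: "a \<in> Units ?R \<longleftrightarrow> unit_in A a" for a
    by (auto simp: Units_def unit_in_def ring_of_type_algebra_def mult.commute)
  have pf: "properfactor ?R b p \<longleftrightarrow> (\<exists>c \<in> A. p = b * c) \<and> \<not> (\<exists>c \<in> A. b = p * c)" for b
    by (auto simp: properfactor_def factor_def ring_of_type_algebra_def)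
  have eq: "(\<forall>b \<in> A. (\<exists>c \<in> A. p = b * c) \<and> \<not> (\<exists>c \<in> A. b = p * c) \<longrightarrow> unit_in A b) \<longleftrightarrow>
    (\<forall>a \<in> A. \<forall>b \<in> A. p = a * b \<longrightarrow> unit_in A a \<or> unit_in A b)" if "p \<in> A" "p \<noteq> 0"
  proof (intro iffI ballI impI)
    fix a b assume *: "\<forall>b \<in> A. (\<exists>c \<in> A. p = b * c) \<and> \<not> (\<exists>c \<in> A. b = p * c) \<longrightarrow> unit_in A b"
      "a \<in> A" "b \<in> A" "p = a * b"
    show "unit_in A a \<or> unit_in A b"
    proof (rule disjCI)
      assume "\<not> unit_in A b"
      show "unit_in A a"
      proof (rule ccontr)
        assume "\<not> unit_in A a"
        with * obtain c where c: "c \<in> A" "a = p * c" by blast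
        then have "a * (b * c) = a * 1" using *(4) by (metis mult.assoc mult_1_right)
        moreover have "a \<noteq> 0" using *(4) \<open>p \<noteq> 0\<close> by auto
        ultimately have "b * c = 1" by (metis mult_left_cancel)
        with \<open>\<not> unit_in A b\<close> *(3) c(1) show False unfolding unit_in_def by blast
      qed
    qed
  next
    fix b assume *: "\<forall>a \<in> A. \<forall>b \<in> A. p = a * b \<longrightarrow> unit_in A a \<or> unit_in A b" "b \<in> A"
      "(\<exists>c \<in> A. p = b * c) \<and> \<not> (\<exists>c \<in> A. b = p * c)"
    then obtain c where c: "c \<in> A" "p = b * c" by blast
    have "\<not> unit_in A c"
    proof
      assume "unit_in A c"
      then obtain e where "e \<in> A" "c * e = 1" by (auto simp: unit_in_def)
      then have "b = p * e" using c by (simp add: mult.assoc)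
      with * \<open>e \<in> A\<close> show False by blast
    qed
    then show "unit_in A b" using * c by blast
  qed
  have R: "carrier ?R = A" "\<zero>\<^bsub>?R\<^esub> = 0"
    by (simp_all add: ring_of_type_algebra_def)
  show ?thesis
    unfolding irreducible_in_def ring_irreducible_def Divisibility.irreducible_def units pf R
    by (intro conj_cong refl) (rule eq)
qed

section \<open>Ring morphisms between ambient types, and transport along isomorphisms of
  subrings\<close>

locale ring_morphism =
  fixes h :: "'a::comm_ring_1 \<Rightarrow> 'b::comm_ring_1"
  assumes add: "h (a + b) = h a + h b"
    and mult: "h (a * b) = h a * h b"
    and one: "h 1 = 1"
begin

lemma zero: "h 0 = 0"
  using add[of 0 0] by simp

lemma uminus: "h (- a) = - h a"
  using add[of a "- a"] zero by (simp add: eq_neg_iff_add_eq_0 add.commute)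

lemma diff: "h (a - b) = h a - h b"
  using add[of a "- b"] uminus by simp

lemma power: "h (a ^ n) = h a ^ n"
  by (induction n) (auto simp: one mult)

lemma sum: "h (sum f I) = (\<Sum>i\<in>I. h (f i))"
  by (induction I rule: infinite_finite_induct) (auto simp: zero add)

lemma prod: "h (prod f I) = (\<Prod>i\<in>I. h (f i))"
  by (induction I rule: infinite_finite_induct) (auto simp: one mult)

lemma poly: "h (poly P x) = poly (map_poly h P) (h x)"
  by (induction P) (auto simp: zero add mult map_poly_pCons)

lemma map_poly: "ring_morphism (map_poly h)"
proof
  fix p q :: "'a poly"
  show "map_poly h (p + q) = map_poly h p + map_poly h q"
    by (intro poly_eqI) (simp add: coeff_map_poly zero add)
  show "map_poly h (p * q) = map_poly h p * map_poly h q"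
    by (intro poly_eqI) (simp add: coeff_map_poly zero coeff_mult sum mult)
  show "map_poly h 1 = 1"
    by (rule map_poly_1') (rule one)
qed

end

lemma pderiv_map_poly:
  fixes h :: "'a::idom \<Rightarrow> 'b::idom"
  assumes "ring_morphism h"
  shows "pderiv (map_poly h p) = map_poly h (pderiv p)"
proof (intro poly_eqI)
  interpret ring_morphism h by fact
  fix n
  have "h (of_nat m) = of_nat m" for m
    by (induction m) (auto simp: zero one add)
  then show "poly.coeff (pderiv (map_poly h p)) n = poly.coeff (map_poly h (pderiv p)) n"
    by (simp add: coeff_pderiv coeff_map_poly zero mult add one)
qed

lemma ring_morphism_comp: "ring_morphism f \<Longrightarrow> ring_morphism g \<Longrightarrow> ring_morphism (\<lambda>x. f (g x))"
  by (simp add: ring_morphism_def)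

lemma unit_in_iso:
  assumes "ring_morphism h" "bij_betw h A B" "a \<in> A" "subring_set A"
  shows "unit_in B (h a) \<longleftrightarrow> unit_in A a"
proof
  interpret ring_morphism h by fact
  show "unit_in B (h a)" if u: "unit_in A a"
  proof -
    obtain b where "b \<in> A" "a * b = 1" using u unfolding unit_in_def by blast
    then have "h a * h b = 1" by (metis mult one)
    then show ?thesis using assms \<open>b \<in> A\<close> by (auto simp: unit_in_def bij_betw_def)
  qed
  show "unit_in A a" if u: "unit_in B (h a)"
  proof -
    obtain b where "b \<in> A" "h a * h b = 1"
      using u assms by (auto simp: unit_in_def bij_betw_def)
    then have "h (a * b) = h 1" "a * b \<in> A" "1 \<in> A"
      using assms by (auto simp: mult one intro: subring_mult subring_one)
    then have "a * b = 1" using assms(2) by (auto simp: bij_betw_def dest: inj_onD)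
    then show ?thesis using assms \<open>b \<in> A\<close> by (auto simp: unit_in_def)
  qed
qed

lemma irreducible_in_iso:
  fixes h :: "'a::idom \<Rightarrow> 'b::idom"
  assumes "ring_morphism h" "bij_betw h A B" "a \<in> A" "subring_set A" "subring_set B"
  shows "irreducible_in B (h a) \<longleftrightarrow> irreducible_in A a"
proof -
  interpret ring_morphism h by fact
  have hA: "h ` A = B" and inj: "inj_on h A"
    using assms(2) by (auto simp: bij_betw_def)
  have "h a = 0 \<longleftrightarrow> a = 0"
    using inj_onD[OF inj, of a 0] assms(3) subring_zero[OF assms(4)] by (auto simp: zero)
  moreover have "h a = h x * h y \<longleftrightarrow> a = x * y" if "x \<in> A" "y \<in> A" for x y
    using inj_onD[OF inj, of a "x * y"] assms(3) subring_mult[OF assms(4) that] by (auto simp: mult)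
  ultimately show ?thesis
    unfolding irreducible_in_iff[OF assms(4)] irreducible_in_iff[OF assms(5)]
    using assms(3) unit_in_iso[OF assms(1,2) _ assms(4)]
    by (auto simp: hA[symmetric])
qed

subsection \<open>Gauss's lemma\<close>

definition dvd_in :: "'a::comm_ring_1 set \<Rightarrow> 'a \<Rightarrow> 'a \<Rightarrow> bool" where
  "dvd_in A a b \<longleftrightarrow> (\<exists>c \<in> A. b = a * c)"

text \<open>The function \<open>\<delta>\<close> takes the place of the number of prime factors.\<close>

definition factorial_set :: "'a::idom set \<Rightarrow> bool" where
  "factorial_set A \<longleftrightarrow> subring_set A \<and>
     (\<exists>\<delta> :: 'a \<Rightarrow> nat.
       (\<forall>a \<in> A. \<forall>b \<in> A. a \<noteq> 0 \<longrightarrow> b \<noteq> 0 \<longrightarrow> \<delta> (a * b) = \<delta> a + \<delta> b) \<and>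
       (\<forall>a \<in> A. a \<noteq> 0 \<longrightarrow> \<delta> a = 0 \<longrightarrow> unit_in A a)) \<and>
     (\<forall>p. irreducible_in A p \<longrightarrow>
       (\<forall>a \<in> A. \<forall>b \<in> A. dvd_in A p (a * b) \<longrightarrow> dvd_in A p a \<or> dvd_in A p b))"

lemma factorial_set_subring: "factorial_set A \<Longrightarrow> subring_set A"
  by (simp add: factorial_set_def)

lemma factorial_set_prime:
  "factorial_set A \<Longrightarrow> irreducible_in A p \<Longrightarrow> a \<in> A \<Longrightarrow> b \<in> A \<Longrightarrow> dvd_in A p (a * b) \<Longrightarrow>
    dvd_in A p a \<or> dvd_in A p b"
  by (simp add: factorial_set_def)

text \<open>Induction along a factorization into irreducibles. Non-units have
  \<open>\<delta> > 0\<close> and \<open>\<delta>\<close> is additive, so \<open>\<delta>\<close>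
  drops both when a reducible element is split and when an irreducible factor is removed.\<close>

lemma factorial_set_induct [consumes 3, case_names unit mult]:
  assumes A: "factorial_set A" and "c \<in> A" "c \<noteq> 0"
    and unit: "\<And>c. unit_in A c \<Longrightarrow> Q c"
    and mult: "\<And>p c. irreducible_in A p \<Longrightarrow> c \<in> A \<Longrightarrow> c \<noteq> 0 \<Longrightarrow> Q c \<Longrightarrow> Q (p * c)"
  shows "Q c"
proof -
  have S: "subring_set A" using A by (rule factorial_set_subring)
  obtain \<delta> :: "'a \<Rightarrow> nat"
    where \<delta>: "\<And>a b. a \<in> A \<Longrightarrow> b \<in> A \<Longrightarrow> a \<noteq> 0 \<Longrightarrow> b \<noteq> 0 \<Longrightarrow> \<delta> (a * b) = \<delta> a + \<delta> b"
      and \<delta>0: "\<And>a. a \<in> A \<Longrightarrow> a \<noteq> 0 \<Longrightarrow> \<delta> a = 0 \<Longrightarrow> unit_in A a"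
    using A unfolding factorial_set_def by blast
  have ex: "\<exists>p e. irreducible_in A p \<and> e \<in> A \<and> c = p * e"
    if "c \<in> A" "c \<noteq> 0" "\<not> unit_in A c" for c
    using that
  proof (induction "\<delta> c" arbitrary: c rule: less_induct)
    case less
    show ?case
    proof (cases "irreducible_in A c")
      case True
      then show ?thesis using subring_one[OF S] by force
    next
      case False
      then obtain a b where ab: "a \<in> A" "b \<in> A" "c = a * b" "\<not> unit_in A a" "\<not> unit_in A b"
        using less by (auto simp: irreducible_in_iff[OF S])
      then have "\<delta> c = \<delta> a + \<delta> b" "\<delta> b \<noteq> 0"
        using less \<delta> \<delta>0 by auto
      then obtain p e where "irreducible_in A p" "e \<in> A" "a = p * e"
        using less.hyps[of a] less.prems ab by auto
      then show ?thesis using ab S by (metis mult.assoc subring_mult)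
    qed
  qed
  show ?thesis using assms(2,3)
  proof (induction "\<delta> c" arbitrary: c rule: less_induct)
    case less
    show ?case
    proof (cases "unit_in A c")
      case False
      then obtain p e where pe: "irreducible_in A p" "e \<in> A" "c = p * e"
        using ex less by metis
      then have "\<delta> c = \<delta> p + \<delta> e" "\<delta> p \<noteq> 0"
        using less \<delta> \<delta>0 by (auto simp: irreducible_in_iff[OF S])
      then have "Q e" using less pe by auto
      then show ?thesis using mult pe less by auto
    qed (auto intro: unit)
  qed
qed

section \<open>Univariate polynomials with coefficients in a subring\<close>

definition polys_over :: "'a::comm_ring_1 set \<Rightarrow> 'a poly set" where
  "polys_over A = {p. \<forall>i. poly.coeff p i \<in> A}"

lemma subring_polys_over: "subring_set A \<Longrightarrow> subring_set (polys_over A)"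
  unfolding subring_set_def[of "polys_over A"]
  by (auto simp: polys_over_def coeff_mult coeff_1
      intro: subring_zero subring_one subring_add subring_mult subring_sum subring_uminus)

lemma pCons_in_polys_over: "pCons a p \<in> polys_over A \<longleftrightarrow> a \<in> A \<and> p \<in> polys_over A"
  by (auto simp: polys_over_def coeff_pCons split: nat.splits)

lemma const_in_polys_over: "subring_set A \<Longrightarrow> [:a:] \<in> polys_over A \<longleftrightarrow> a \<in> A"
  using subring_zero[of A] by (auto simp: pCons_in_polys_over) (simp add: polys_over_def)

lemma monom_in_polys_over: "subring_set A \<Longrightarrow> a \<in> A \<Longrightarrow> Polynomial.monom a k \<in> polys_over A"
  using subring_zero[of A] by (auto simp: polys_over_def)

lemma unit_in_polys_over_iff:
  fixes A :: "'a::idom set"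
  assumes A: "subring_set A"
  shows "unit_in (polys_over A) f \<longleftrightarrow> (\<exists>a. unit_in A a \<and> f = [:a:])"
proof
  assume "unit_in (polys_over A) f"
  then obtain g where g: "f \<in> polys_over A" "g \<in> polys_over A" "f * g = 1"
    by (auto simp: unit_in_def)
  then have "Polynomial.degree (f * g) = 0" "f \<noteq> 0" "g \<noteq> 0" by auto
  then have "Polynomial.degree f = 0" "Polynomial.degree g = 0"
    by (auto simp: degree_mult_eq)
  then obtain a b where ab: "f = [:a:]" "g = [:b:]" by (meson degree_eq_zeroE)
  then show "\<exists>a. unit_in A a \<and> f = [:a:]"
    using g A by (auto simp: unit_in_def const_in_polys_over one_pCons mult.commute)
next
  assume "\<exists>a. unit_in A a \<and> f = [:a:]"
  then obtain a b where ab: "a \<in> A" "b \<in> A" "f = [:a:]" "a * b = 1"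
    by (auto simp: unit_in_def)
  then have "f * [:b:] = 1" by (simp add: one_pCons mult.commute)
  then show "unit_in (polys_over A) f"
    using ab A unfolding unit_in_def by (metis const_in_polys_over)
qed

lemma irreducible_in_const_polys_over:
  fixes A :: "'a::idom set"
  assumes A: "subring_set A"
  shows "irreducible_in (polys_over A) [:a:] \<longleftrightarrow> irreducible_in A a"
proof -
  have "(\<forall>f \<in> polys_over A. \<forall>g \<in> polys_over A. [:a:] = f * g \<longrightarrow>
      unit_in (polys_over A) f \<or> unit_in (polys_over A) g) \<longleftrightarrow>
    (\<forall>x \<in> A. \<forall>y \<in> A. a = x * y \<longrightarrow> unit_in A x \<or> unit_in A y)" if "a \<noteq> 0"
  proof (intro iffI ballI impI)
    fix x y assume *: "\<forall>f \<in> polys_over A. \<forall>g \<in> polys_over A. [:a:] = f * g \<longrightarrow>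
      unit_in (polys_over A) f \<or> unit_in (polys_over A) g" "x \<in> A" "y \<in> A" "a = x * y"
    then have "[:a:] = [:x:] * [:y:]" by simp
    with * show "unit_in A x \<or> unit_in A y"
      using A by (metis const_in_polys_over pCons_eq_iff unit_in_polys_over_iff)
  next
    fix f g assume *: "\<forall>x \<in> A. \<forall>y \<in> A. a = x * y \<longrightarrow> unit_in A x \<or> unit_in A y"
      "f \<in> polys_over A" "g \<in> polys_over A" "[:a:] = f * g"
    have "f \<noteq> 0" "g \<noteq> 0" using * \<open>a \<noteq> 0\<close> by auto
    then have "Polynomial.degree f = 0" "Polynomial.degree g = 0"
      using degree_mult_eq[of f g] *(4) by (metis add_is_0 degree_pCons_0)+
    then obtain x y where xy: "f = [:x:]" "g = [:y:]" by (meson degree_eq_zeroE)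
    then show "unit_in (polys_over A) f \<or> unit_in (polys_over A) g"
      using * A by (auto simp: unit_in_polys_over_iff const_in_polys_over)
  qed
  then show ?thesis
    unfolding irreducible_in_iff[OF A] irreducible_in_iff[OF subring_polys_over[OF A]]
    using A by (auto simp: unit_in_polys_over_iff const_in_polys_over)
qed

lemma dvd_in_const_polys_over:
  fixes A :: "'a::idom set"
  assumes A: "subring_set A"
  shows "dvd_in (polys_over A) [:a:] f \<longleftrightarrow> (\<forall>i. dvd_in A a (poly.coeff f i))"
proof
  assume "dvd_in (polys_over A) [:a:] f"
  then show "\<forall>i. dvd_in A a (poly.coeff f i)"
    by (auto simp: dvd_in_def polys_over_def)
next
  assume R: "\<forall>i. dvd_in A a (poly.coeff f i)"
  show "dvd_in (polys_over A) [:a:] f"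
  proof (cases "a = 0")
    \<comment> \<open>Division by 0 does not determine the quotients, and arbitrary ones need not
      vanish beyond the degree of \<open>f\<close>.\<close>
    case True
    then have "f = [:a:] * 0" "0 \<in> polys_over A"
      using R subring_zero[OF A] by (auto simp: dvd_in_def poly_eq_iff polys_over_def)
    then show ?thesis unfolding dvd_in_def by blast
  next
    case False
    obtain c where c: "\<And>i. c i \<in> A \<and> poly.coeff f i = a * c i"
      using R unfolding dvd_in_def by metis
    define g where "g = Poly (map c [0..<Suc (Polynomial.degree f)])"
    have "poly.coeff g i = c i" for i
    proof (cases "i \<le> Polynomial.degree f")
      case True
      then show ?thesis by (auto simp: g_def nth_default_def simp del: upt_Suc)
    next
      case F: False
      then have "c i = 0" using c[of i] False by (simp add: coeff_eq_0)
      then show ?thesis using F by (auto simp: g_def nth_default_def simp del: upt_Suc)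
    qed
    then have "g \<in> polys_over A" "f = [:a:] * g"
      using c by (auto simp: polys_over_def poly_eq_iff)
    then show ?thesis by (auto simp: dvd_in_def)
  qed
qed

lemma all_nat_split: "(\<forall>i. Q i) \<longleftrightarrow> Q 0 \<and> (\<forall>i. Q (Suc i))"
  by (metis not0_implies_Suc)

text \<open>Since \<open>p\<close> divides the product of the two constant coefficients, it divides
  one of them. Subtracting the contribution of that coefficient leaves X times a product in which
  the corresponding factor has lost its constant term, which is where the induction on that factor
  applies.\<close>

lemma prime_const_polys_over:
  fixes A :: "'a::idom set"
  assumes A: "factorial_set A" and p: "irreducible_in A p"
    and "f \<in> polys_over A" "g \<in> polys_over A" "dvd_in (polys_over A) [:p:] (f * g)"
  shows "dvd_in (polys_over A) [:p:] f \<or> dvd_in (polys_over A) [:p:] g"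
proof -
  have S: "subring_set A" using A by (rule factorial_set_subring)
  let ?D = "dvd_in (polys_over A) [:p:]"
  have D_pCons: "?D (pCons a f) \<longleftrightarrow> dvd_in A p a \<and> ?D f" for a f
    unfolding dvd_in_const_polys_over[OF S] all_nat_split[of "\<lambda>i. dvd_in A p (poly.coeff (pCons a f) i)"]
    by simp
  have D_mult: "?D (f * g)" if D: "?D f" "g \<in> polys_over A" for f g
  proof -
    obtain k where "k \<in> polys_over A" "f = [:p:] * k"
      using D(1) unfolding dvd_in_def by blast
    then have "k * g \<in> polys_over A" "f * g = [:p:] * (k * g)"
      using D(2) subring_mult[OF subring_polys_over[OF S]] by (auto simp only: mult.assoc)
    then show ?thesis unfolding dvd_in_def by blast
  qed
  have D_diff: "?D (f - g)" if D: "?D f" "?D g" for f g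
  proof -
    obtain k l where "k \<in> polys_over A" "f = [:p:] * k" "l \<in> polys_over A" "g = [:p:] * l"
      using D unfolding dvd_in_def by blast
    then have "k - l \<in> polys_over A" "f - g = [:p:] * (k - l)"
      using subring_diff[OF subring_polys_over[OF S]] by (auto simp only: right_diff_distrib)
    then show ?thesis unfolding dvd_in_def by blast
  qed
  have D_0: "?D 0" using subring_zero[OF subring_polys_over[OF S]] unfolding dvd_in_def by (metis mult_zero_right)
  have "\<forall>g \<in> polys_over A. ?D (f * g) \<longrightarrow> ?D f \<or> ?D g" using assms(3)
  proof (induction f)
    case 0
    then show ?case using D_0 by auto
  next
    case (pCons a f)
    note IH_f = pCons.IH
    from pCons.prems have a: "a \<in> A" and f: "f \<in> polys_over A" by (auto simp: pCons_in_polys_over)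
    show ?case
    proof
      fix g assume "g \<in> polys_over A"
      then show "?D (pCons a f * g) \<longrightarrow> ?D (pCons a f) \<or> ?D g"
      proof (induction g)
        case 0
        then show ?case using D_0 by auto
      next
        case (pCons b g)
        from pCons.prems have b: "b \<in> A" and g: "g \<in> polys_over A"
          by (auto simp: pCons_in_polys_over)
        show ?case
        proof
          assume D: "?D (pCons a f * pCons b g)"
          have "poly.coeff (pCons a f * pCons b g) 0 = a * b" by (simp add: coeff_mult)
          moreover have "dvd_in A p (poly.coeff (pCons a f * pCons b g) 0)"
            using D unfolding dvd_in_const_polys_over[OF S] by (rule spec)
          ultimately have "dvd_in A p (a * b)" by (simp only:)
          then consider "dvd_in A p a" | "dvd_in A p b"
            using factorial_set_prime[OF A p a b] by auto
          then show "?D (pCons a f) \<or> ?D (pCons b g)"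
          proof cases
            case 1
            then have "?D [:a:]" using D_0 by (simp add: D_pCons)
            then have "?D ([:a:] * pCons b g)" using pCons.prems by (rule D_mult)
            then have "?D (pCons a f * pCons b g - [:a:] * pCons b g)" using D by (intro D_diff)
            also have "pCons a f * pCons b g - [:a:] * pCons b g = pCons 0 (f * pCons b g)"
              by simp
            finally have "?D (f * pCons b g)" by (simp add: D_pCons)
            then have "?D f \<or> ?D (pCons b g)" using IH_f[OF f] pCons.prems by blast
            then show ?thesis using 1 by (simp only: D_pCons) blast
          next
            case 2
            then have "?D [:b:]" using D_0 by (simp add: D_pCons)
            then have "?D ([:b:] * pCons a f)"
              using \<open>pCons a f \<in> polys_over A\<close> by (rule D_mult)
            then have "?D (pCons a f * pCons b g - [:b:] * pCons a f)" using D by (intro D_diff)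
            also have "pCons a f * pCons b g - [:b:] * pCons a f = pCons 0 (pCons a f * g)"
              by (simp add: mult.commute)
            finally have "?D (pCons a f * g)" by (simp only: D_pCons)
            then have "?D (pCons a f) \<or> ?D g" using pCons.IH[OF g] by blast
            then show ?thesis using 2 by (simp only: D_pCons) blast
          qed
        qed
      qed
    qed
  qed
  then show ?thesis using assms(4,5) by blast
qed

text \<open>Leading coefficients are not invertible in \<open>A\<close>, so each division step first
  multiplies \<open>f\<close> by the leading coefficient of \<open>g\<close>; these multipliers
  accumulate in \<open>c\<close>.\<close>

lemma pseudo_division:
  fixes A :: "'a::idom set"
  assumes A: "subring_set A" and g: "g \<in> polys_over A" "g \<noteq> 0" and f: "f \<in> polys_over A"
  shows "\<exists>c q r. c \<in> A \<and> c \<noteq> 0 \<and> q \<in> polys_over A \<and> r \<in> polys_over A \<and>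
    Polynomial.smult c f = q * g + r \<and> (r = 0 \<or> Polynomial.degree r < Polynomial.degree g)"
  using f
proof (induction "Polynomial.degree f" arbitrary: f rule: less_induct)
  case less
  note PA = subring_polys_over[OF A]
  show ?case
  proof (cases "f = 0 \<or> Polynomial.degree f < Polynomial.degree g")
    case True
    then show ?thesis
      using less.prems subring_zero[OF PA] subring_one[OF A]
      by (intro exI[of _ 1] exI[of _ 0] exI[of _ f]) auto
  next
    case False
    let ?b = "lead_coeff g"
    define m where "m = Polynomial.monom (lead_coeff f) (Polynomial.degree f - Polynomial.degree g)"
    define f' where "f' = Polynomial.smult ?b f - m * g"
    have b: "?b \<in> A" "?b \<noteq> 0" and lf: "lead_coeff f \<in> A"
      using g less.prems by (auto simp: polys_over_def)
    have m: "m \<in> polys_over A" unfolding m_def using A lf by (rule monom_in_polys_over)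
    have deg_m: "Polynomial.degree m = Polynomial.degree f - Polynomial.degree g"
      and lc_m: "lead_coeff m = lead_coeff f" and m0: "m \<noteq> 0"
      using False by (simp_all add: m_def degree_monom_eq monom_eq_0_iff)
    have bf: "Polynomial.smult ?b f \<in> polys_over A"
      using less.prems b by (auto simp: polys_over_def intro: subring_mult[OF A])
    have f': "f' \<in> polys_over A"
      unfolding f'_def using bf m g PA by (auto intro: subring_diff subring_mult)
    have deg: "Polynomial.degree (m * g) = Polynomial.degree f"
      using False m0 g(2) deg_m by (simp add: degree_mult_eq)
    have "poly.coeff (m * g) (Polynomial.degree f) = lead_coeff f * ?b"
      unfolding deg[symmetric] lead_coeff_mult lc_m ..
    then have top: "poly.coeff f' (Polynomial.degree f) = 0"
      unfolding f'_def by (simp add: mult.commute)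
    have "Polynomial.degree f' \<le> Polynomial.degree f"
      unfolding f'_def by (intro degree_diff_le) (simp_all add: deg degree_smult_le)
    then have "f' = 0 \<or> Polynomial.degree f' < Polynomial.degree f"
      using top by (metis le_neq_implies_less leading_coeff_0_iff)
    then obtain c q r where IH: "c \<in> A" "c \<noteq> 0" "q \<in> polys_over A" "r \<in> polys_over A"
      "Polynomial.smult c f' = q * g + r" "r = 0 \<or> Polynomial.degree r < Polynomial.degree g"
    proof
      \<comment> \<open>If \<open>f\<close> is a constant then \<open>f' = 0\<close> has no smaller
        degree, so the induction hypothesis would not cover it.\<close>
      assume "f' = 0"
      then show thesis
        using that[of 1 0 0] subring_zero[OF PA] subring_one[OF A] by simp
    next
      assume "Polynomial.degree f' < Polynomial.degree f"
      from less.hyps[OF this f'] show thesis using that by blast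
    qed
    have cm: "Polynomial.smult c m \<in> polys_over A"
      using m IH(1) by (auto simp: polys_over_def intro: subring_mult[OF A])
    have "Polynomial.smult (c * ?b) f = Polynomial.smult c f' + Polynomial.smult c m * g"
      by (simp add: f'_def smult_diff_right)
    also have "\<dots> = (q + Polynomial.smult c m) * g + r"
      by (simp only: IH(5) distrib_right add_ac)
    finally have "Polynomial.smult (c * ?b) f = (q + Polynomial.smult c m) * g + r" .
    moreover have "c * ?b \<in> A" "c * ?b \<noteq> 0" "q + Polynomial.smult c m \<in> polys_over A"
      using IH b cm A PA by (auto intro: subring_mult subring_add)
    ultimately show ?thesis using IH(4,6) by blast
  qed
qed

lemma smult_cancel:
  fixes p q :: "'a::idom poly"
  shows "a \<noteq> 0 \<Longrightarrow> Polynomial.smult a p = Polynomial.smult a q \<Longrightarrow> p = q"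
  by (simp add: poly_eq_iff)

text \<open>The primes dividing \<open>c\<close> stay prime in \<open>A[X]\<close>, so each of them divides \<open>q\<close> or \<open>w\<close>.\<close>

lemma distribute_constant_factor:
  fixes A :: "'a::idom set"
  assumes A: "factorial_set A" and "c \<in> A" "c \<noteq> 0" and "f \<in> polys_over A"
    and "q \<in> polys_over A" "w \<in> polys_over A" "Polynomial.smult c f = q * w"
  shows "\<exists>c1 c2 q' w'. c1 \<in> A \<and> c2 \<in> A \<and> q' \<in> polys_over A \<and> w' \<in> polys_over A \<and>
    q = Polynomial.smult c1 q' \<and> w = Polynomial.smult c2 w' \<and> f = q' * w'"
proof -
  have S: "subring_set A" using A by (rule factorial_set_subring)
  have smult: "Polynomial.smult a p \<in> polys_over A" if "a \<in> A" "p \<in> polys_over A" for a p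
    using that by (auto simp: polys_over_def intro: subring_mult[OF S])
  show ?thesis using assms(1-3,5-)
  proof (induction arbitrary: q w rule: factorial_set_induct)
    case (unit c)
    then obtain e where e: "e \<in> A" "c \<in> A" "c * e = 1" by (auto simp: unit_in_def)
    have "Polynomial.smult e (Polynomial.smult c f) = Polynomial.smult e q * w"
      using unit by simp
    then have "f = Polynomial.smult e q * w" using e by (simp add: mult.commute)
    moreover have "q = Polynomial.smult c (Polynomial.smult e q)" "w = Polynomial.smult 1 w"
      using e by auto
    ultimately show ?case using e unit smult subring_one[OF S] by metis
  next
    case (mult p c)
    have p: "p \<in> A" "p \<noteq> 0" using mult(1) by (auto simp: irreducible_in_iff[OF S])
    have "Polynomial.smult c f \<in> polys_over A" using mult assms smult by auto
    moreover have "q * w = [:p:] * Polynomial.smult c f"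
      unfolding mult.prems(3)[symmetric] by (simp add: Groups.mult.commute)
    ultimately have "dvd_in (polys_over A) [:p:] (q * w)" unfolding dvd_in_def by blast
    then consider q' where "q' \<in> polys_over A" "q = Polynomial.smult p q'"
      | w' where "w' \<in> polys_over A" "w = Polynomial.smult p w'"
      using prime_const_polys_over[OF A mult(1) mult(5,6)] unfolding dvd_in_def by auto
    then show ?case
    proof cases
      case 1
      have "Polynomial.smult p (Polynomial.smult c f) = Polynomial.smult p (q' * w)"
        using mult.prems(3) 1(2) by simp
      then have "Polynomial.smult c f = q' * w" using p by (metis smult_cancel)
      then obtain c1 c2 q'' w'' where *: "c1 \<in> A" "c2 \<in> A" "q'' \<in> polys_over A" "w'' \<in> polys_over A"
        "q' = Polynomial.smult c1 q''" "w = Polynomial.smult c2 w''" "f = q'' * w''"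
        using mult(4)[OF 1(1) mult(6)] by blast
      then have "q = Polynomial.smult (p * c1) q''" "p * c1 \<in> A"
        using 1 p by (auto intro: subring_mult[OF S])
      with * show ?thesis by blast
    next
      case w: 2
      have "Polynomial.smult p (Polynomial.smult c f) = Polynomial.smult p (q * w')"
        using mult.prems(3) w(2) by simp
      then have "Polynomial.smult c f = q * w'" using p by (metis smult_cancel)
      then obtain c1 c2 q'' w'' where *: "c1 \<in> A" "c2 \<in> A" "q'' \<in> polys_over A" "w'' \<in> polys_over A"
        "q = Polynomial.smult c1 q''" "w' = Polynomial.smult c2 w''" "f = q'' * w''"
        using mult(4)[OF mult(5) w(1)] by blast
      then have "w = Polynomial.smult (p * c2) w''" "p * c2 \<in> A"
        using w p by (auto intro: subring_mult[OF S])
      with * show ?thesis by blast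
    qed
  qed
qed

text \<open>The prime factors of \<open>c\<close> are distributed over \<open>f\<close> and the
  cofactor. What falls to \<open>f\<close> must be a unit, as \<open>f\<close> is irreducible of
  positive degree, so the whole of \<open>c\<close> can be cancelled from the cofactor up to a
  unit.\<close>

lemma irreducible_in_polys_over_dvd:
  fixes A :: "'a::idom set"
  assumes A: "factorial_set A" and f: "irreducible_in (polys_over A) f"
    and deg: "Polynomial.degree f > 0" and c: "c \<in> A" "c \<noteq> 0" and h: "h \<in> polys_over A"
    and dvd: "dvd_in (polys_over A) f (Polynomial.smult c h)"
  shows "dvd_in (polys_over A) f h"
proof -
  have S: "subring_set A" using A by (rule factorial_set_subring)
  note PS = subring_polys_over[OF S]
  have f0: "f \<in> polys_over A" "f \<noteq> 0"
    using f by (auto simp: irreducible_in_iff[OF PS])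
  obtain k where k: "k \<in> polys_over A" "Polynomial.smult c h = f * k"
    using dvd by (auto simp: dvd_in_def)
  obtain c1 c2 f' k' where *: "c1 \<in> A" "f' \<in> polys_over A" "k' \<in> polys_over A"
    "f = Polynomial.smult c1 f'" "h = f' * k'"
    using distribute_constant_factor[OF A c h f0(1) k] by blast
  have f_eq: "f = [:c1:] * f'" using *(4) by simp
  have "Polynomial.degree f' > 0" using deg *(4) by (auto split: if_splits)
  then have "\<not> unit_in (polys_over A) f'"
    by (auto simp: unit_in_polys_over_iff[OF S])
  then have "unit_in (polys_over A) [:c1:]"
    using f f_eq * const_in_polys_over[OF S] unfolding irreducible_in_iff[OF PS] by blast
  then have "unit_in A c1" by (auto simp: unit_in_polys_over_iff[OF S])
  then obtain e where e: "e \<in> A" "c1 * e = 1" unfolding unit_in_def by blast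
  then have "h = f * Polynomial.smult e k'" using * by (simp add: mult.commute)
  moreover have "Polynomial.smult e k' \<in> polys_over A"
    using e * by (auto simp: polys_over_def intro: subring_mult[OF S])
  ultimately show ?thesis unfolding dvd_in_def by blast
qed

text \<open>Bezout's identity over the fraction field with denominators cleared. By pseudo-division,
  an element \<open>w\<close> of least degree in the ideal generated by \<open>f\<close> and
  \<open>g\<close> divides every element up to a constant factor. As \<open>f\<close> is
  irreducible, \<open>w\<close> is a constant or agrees with \<open>f\<close> up to a constant
  factor.\<close>

lemma irreducible_in_polys_over_bezout:
  fixes A :: "'a::idom set"
  assumes A: "factorial_set A" and f: "irreducible_in (polys_over A) f"
    and deg: "Polynomial.degree f > 0" and g: "g \<in> polys_over A"
    and ndvd: "\<not> dvd_in (polys_over A) f g"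
  shows "\<exists>u v c. u \<in> polys_over A \<and> v \<in> polys_over A \<and> c \<in> A \<and> c \<noteq> 0 \<and> u * f + v * g = [:c:]"
proof -
  have S: "subring_set A" using A by (rule factorial_set_subring)
  note PS = subring_polys_over[OF S]
  have f0: "f \<in> polys_over A" "f \<noteq> 0" "\<not> unit_in (polys_over A) f"
    using f by (auto simp: irreducible_in_iff[OF PS])
  have smult: "Polynomial.smult a p \<in> polys_over A" if "a \<in> A" "p \<in> polys_over A" for a p
    using that by (auto simp: polys_over_def intro: subring_mult[OF S])
  define I where "I = {u * f + v * g | u v. u \<in> polys_over A \<and> v \<in> polys_over A}"
  have I_comb: "Polynomial.smult a p - q * r \<in> I"
    if h: "p \<in> I" "r \<in> I" "a \<in> A" "q \<in> polys_over A" for a p q r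
  proof -
    obtain u v where "p = u * f + v * g" "u \<in> polys_over A" "v \<in> polys_over A"
      using h(1) unfolding I_def by blast
    moreover obtain u' v' where "r = u' * f + v' * g" "u' \<in> polys_over A" "v' \<in> polys_over A"
      using h(2) unfolding I_def by blast
    ultimately show ?thesis unfolding I_def
      using h(3,4) by (intro CollectI exI[of _ "Polynomial.smult a u - q * u'"]
          exI[of _ "Polynomial.smult a v - q * v'"])
        (auto simp: algebra_simps smult_add_right intro!: subring_diff[OF PS] smult subring_mult[OF PS])
  qed
  have "f = 1 * f + 0 * g" "g = 0 * f + 1 * g" by auto
  then have fg_I: "f \<in> I" "g \<in> I"
    unfolding I_def using subring_one[OF PS] subring_zero[OF PS] by blast+
  have I_sub: "I \<subseteq> polys_over A"
    unfolding I_def using f0(1) g PS by (auto intro: subring_add subring_mult)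
  obtain w where w: "w \<in> I" "w \<noteq> 0"
    and w_min: "\<And>r. r \<in> I \<Longrightarrow> r \<noteq> 0 \<Longrightarrow> Polynomial.degree w \<le> Polynomial.degree r"
  proof -
    have "\<exists>w. (w \<in> I \<and> w \<noteq> 0) \<and> (\<forall>r. r \<in> I \<and> r \<noteq> 0 \<longrightarrow> Polynomial.degree w \<le> Polynomial.degree r)"
      using f0 fg_I ex_has_least_nat[of "\<lambda>w. w \<in> I \<and> w \<noteq> 0" f Polynomial.degree] by auto
    then show thesis using that by blast
  qed
  have wA: "w \<in> polys_over A" using w I_sub by auto
  have divides: "\<exists>c q. c \<in> A \<and> c \<noteq> 0 \<and> q \<in> polys_over A \<and> Polynomial.smult c h = q * w"
    if h: "h \<in> I" for h
  proof -
    obtain c q r where *: "c \<in> A" "c \<noteq> 0" "q \<in> polys_over A" "Polynomial.smult c h = q * w + r"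
      "r = 0 \<or> Polynomial.degree r < Polynomial.degree w"
      using pseudo_division[OF S wA w(2), of h] h I_sub by blast
    have "r = Polynomial.smult c h - q * w" using *(4) by simp
    then have "r \<in> I" using I_comb[OF h w(1) *(1,3)] by simp
    then have "r = 0" using w_min[of r] *(5) by (meson not_le)
    then show ?thesis using * by auto
  qed
  obtain c q where cq: "c \<in> A" "c \<noteq> 0" "q \<in> polys_over A" "Polynomial.smult c f = q * w"
    using divides[OF fg_I(1)] by blast
  obtain c1 c2 q' w' where *: "c1 \<in> A" "c2 \<in> A" "q' \<in> polys_over A" "w' \<in> polys_over A"
    "q = Polynomial.smult c1 q'" "w = Polynomial.smult c2 w'" "f = q' * w'"
    using distribute_constant_factor[OF A cq(1,2) f0(1) cq(3) wA cq(4)] by blast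
  have "unit_in (polys_over A) q' \<or> unit_in (polys_over A) w'"
    using f *(3,4,7) unfolding irreducible_in_iff[OF PS] by blast
  then have "unit_in (polys_over A) w'"
  proof (rule disjE)
    \<comment> \<open>Here \<open>w\<close> is a multiple of \<open>f\<close>, so \<open>f\<close>
      divides a constant multiple of \<open>g\<close>, against \<open>ndvd\<close>.\<close>
    assume "unit_in (polys_over A) q'"
    then obtain a e where a: "a \<in> A" "e \<in> A" "q' = [:a:]" "a * e = 1"
      unfolding unit_in_polys_over_iff[OF S] unfolding unit_in_def by blast
    have "f = Polynomial.smult a w'" using * a by simp
    then have "f * [:c2 * e:] = Polynomial.smult (c2 * (a * e)) w'" by (simp add: ac_simps)
    then have w_eq: "w = f * [:c2 * e:]" using *(6) a(4) by simp
    obtain c' q'' where c': "c' \<in> A" "c' \<noteq> 0" "q'' \<in> polys_over A" "Polynomial.smult c' g = q'' * w"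
      using divides[OF fg_I(2)] by blast
    have "Polynomial.smult c' g = f * (q'' * [:c2 * e:])" using c' w_eq by (simp add: mult.commute)
    moreover have "q'' * [:c2 * e:] \<in> polys_over A"
      using c'(3) *(2) a(2) S PS const_in_polys_over[OF S] by (meson subring_mult)
    ultimately have "dvd_in (polys_over A) f (Polynomial.smult c' g)"
      unfolding dvd_in_def by blast
    then show ?thesis
      using irreducible_in_polys_over_dvd[OF A f deg c'(1,2) g] ndvd by blast
  qed
  then obtain a where "w' = [:a:]" "a \<in> A"
    unfolding unit_in_polys_over_iff[OF S] unfolding unit_in_def by blast
  then have "w = [:c2 * a:]" "c2 * a \<in> A" "c2 * a \<noteq> 0"
    using * w(2) by (auto intro: subring_mult[OF S])
  then show ?thesis using w(1) unfolding I_def by force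
qed

lemma factorial_setI:
  fixes \<delta> :: "'a::idom \<Rightarrow> nat"
  assumes "subring_set A"
    and "\<And>a b. a \<in> A \<Longrightarrow> b \<in> A \<Longrightarrow> a \<noteq> 0 \<Longrightarrow> b \<noteq> 0 \<Longrightarrow> \<delta> (a * b) = \<delta> a + \<delta> b"
    and "\<And>a. a \<in> A \<Longrightarrow> a \<noteq> 0 \<Longrightarrow> \<delta> a = 0 \<Longrightarrow> unit_in A a"
    and "\<And>p a b. irreducible_in A p \<Longrightarrow> a \<in> A \<Longrightarrow> b \<in> A \<Longrightarrow> dvd_in A p (a * b) \<Longrightarrow>
      dvd_in A p a \<or> dvd_in A p b"
  shows "factorial_set A"
  unfolding factorial_set_def using assms by blast

text \<open>Irreducible constants are prime by \<open>prime_const_polys_over\<close>. If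
  \<open>f\<close> has positive degree and does not divide \<open>a\<close>, multiplying a Bezout
  identity for \<open>f\<close> and \<open>a\<close> by \<open>b\<close> shows that \<open>f\<close>
  divides a constant multiple of \<open>b\<close>, hence \<open>b\<close> itself.\<close>

lemma factorial_set_polys_over:
  fixes A :: "'a::idom set"
  assumes A: "factorial_set A"
  shows "factorial_set (polys_over A)"
proof -
  have S: "subring_set A" using A by (rule factorial_set_subring)
  note PS = subring_polys_over[OF S]
  obtain \<delta> :: "'a \<Rightarrow> nat"
    where \<delta>: "\<And>a b. a \<in> A \<Longrightarrow> b \<in> A \<Longrightarrow> a \<noteq> 0 \<Longrightarrow> b \<noteq> 0 \<Longrightarrow> \<delta> (a * b) = \<delta> a + \<delta> b"
      and \<delta>0: "\<And>a. a \<in> A \<Longrightarrow> a \<noteq> 0 \<Longrightarrow> \<delta> a = 0 \<Longrightarrow> unit_in A a"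
    using A unfolding factorial_set_def by blast
  \<comment> \<open>Degrees add and leading coefficients multiply, so this is additive. If it is 0,
    the polynomial is a constant with \<open>\<delta> = 0\<close>, hence a unit.\<close>
  let ?\<epsilon> = "\<lambda>f. Polynomial.degree f + \<delta> (lead_coeff f)"
  have "?\<epsilon> (f * g) = ?\<epsilon> f + ?\<epsilon> g"
    if "f \<in> polys_over A" "g \<in> polys_over A" "f \<noteq> 0" "g \<noteq> 0" for f g
    unfolding lead_coeff_mult using that \<delta>[of "lead_coeff f" "lead_coeff g"]
    by (simp add: degree_mult_eq polys_over_def)
  moreover have "unit_in (polys_over A) f"
    if f: "f \<in> polys_over A" "f \<noteq> 0" "?\<epsilon> f = 0" for f
  proof -
    obtain a where a: "f = [:a:]" using f(3) by (meson add_is_0 degree_eq_zeroE)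
    then have "unit_in A a" using f \<delta>0 by (auto simp: const_in_polys_over[OF S])
    then show ?thesis using a by (auto simp: unit_in_polys_over_iff[OF S])
  qed
  moreover have "dvd_in (polys_over A) f a \<or> dvd_in (polys_over A) f b"
    if f: "irreducible_in (polys_over A) f" and ab: "a \<in> polys_over A" "b \<in> polys_over A"
      and dvd: "dvd_in (polys_over A) f (a * b)" for f a b
  proof (cases "Polynomial.degree f = 0")
    case True
    then obtain p where p: "f = [:p:]" by (meson degree_eq_zeroE)
    then have "irreducible_in A p" using f irreducible_in_const_polys_over[OF S] by blast
    then show ?thesis using prime_const_polys_over[OF A _ ab] dvd p by blast
  next
    case False
    then have deg: "Polynomial.degree f > 0" by simp
    have "dvd_in (polys_over A) f b" if "\<not> dvd_in (polys_over A) f a"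
    proof -
      from irreducible_in_polys_over_bezout[OF A f deg ab(1) that]
      obtain u v c where uv: "u \<in> polys_over A" "v \<in> polys_over A" "c \<in> A" "c \<noteq> 0"
        "u * f + v * a = [:c:]" by blast
      obtain k where k: "k \<in> polys_over A" "a * b = f * k" using dvd by (auto simp: dvd_in_def)
      have "Polynomial.smult c b = [:c:] * b" by simp
      also have "\<dots> = u * f * b + v * (a * b)"
        unfolding uv(5)[symmetric] by (simp add: algebra_simps)
      also have "\<dots> = f * (u * b + v * k)"
        unfolding k(2) by (simp add: algebra_simps)
      finally have "dvd_in (polys_over A) f (Polynomial.smult c b)"
        unfolding dvd_in_def using uv(1,2) k(1) ab PS by (blast intro: subring_add subring_mult)
      then show "dvd_in (polys_over A) f b"
        by (rule irreducible_in_polys_over_dvd[OF A f deg uv(3,4) ab(2)])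
    qed
    then show ?thesis by blast
  qed
  ultimately show ?thesis
    by (intro factorial_setI[OF PS, of ?\<epsilon>]) blast+
qed

lemma factorial_set_iso:
  fixes h :: "'a::idom \<Rightarrow> 'b::idom"
  assumes h: "ring_morphism h" and bij: "bij_betw h A B"
    and A: "factorial_set A" and B: "subring_set B"
  shows "factorial_set B"
proof -
  interpret ring_morphism h by fact
  have S: "subring_set A" using A by (rule factorial_set_subring)
  define g where "g = the_inv_into A h"
  have g: "g b \<in> A" "h (g b) = b" if "b \<in> B" for b
    using bij that unfolding g_def bij_betw_def
    by (auto intro: the_inv_into_into f_the_inv_into_f)
  have gh: "g (h a) = a" if "a \<in> A" for a
    using bij that unfolding g_def bij_betw_def by (simp add: the_inv_into_f_f)
  have hA: "h a \<in> B" if "a \<in> A" for a using bij that by (auto simp: bij_betw_def)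
  have g_mult: "g (a * b) = g a * g b" if "a \<in> B" "b \<in> B" for a b
    using gh[of "g a * g b"] g that subring_mult[OF S] by (simp add: mult)
  have g0: "g b \<noteq> 0" if "b \<in> B" "b \<noteq> 0" for b
    using g(2)[OF that(1)] that(2) zero by auto
  obtain \<delta> :: "'a \<Rightarrow> nat"
    where \<delta>: "\<And>a b. a \<in> A \<Longrightarrow> b \<in> A \<Longrightarrow> a \<noteq> 0 \<Longrightarrow> b \<noteq> 0 \<Longrightarrow> \<delta> (a * b) = \<delta> a + \<delta> b"
      and \<delta>0: "\<And>a. a \<in> A \<Longrightarrow> a \<noteq> 0 \<Longrightarrow> \<delta> a = 0 \<Longrightarrow> unit_in A a"
    using A unfolding factorial_set_def by blast
  have "\<forall>a \<in> B. \<forall>b \<in> B. a \<noteq> 0 \<longrightarrow> b \<noteq> 0 \<longrightarrow> \<delta> (g (a * b)) = \<delta> (g a) + \<delta> (g b)"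
    using \<delta> g g0 g_mult by simp
  moreover have "\<forall>a \<in> B. a \<noteq> 0 \<longrightarrow> \<delta> (g a) = 0 \<longrightarrow> unit_in B a"
    using \<delta>0 g g0 unit_in_iso[OF h bij _ S] by metis
  moreover have "dvd_in B p a \<or> dvd_in B p b"
    if p: "irreducible_in B p" and ab: "a \<in> B" "b \<in> B" and dvd: "dvd_in B p (a * b)" for p a b
  proof -
    have pB: "p \<in> B" using p by (simp add: irreducible_in_def)
    have dvd_iff: "dvd_in B x y \<longleftrightarrow> dvd_in A (g x) (g y)" if xy: "x \<in> B" "y \<in> B" for x y
    proof
      assume "dvd_in B x y"
      then obtain z where "z \<in> B" "y = x * z" by (auto simp: dvd_in_def)
      then show "dvd_in A (g x) (g y)" unfolding dvd_in_def using g_mult xy g(1) by blast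
    next
      assume "dvd_in A (g x) (g y)"
      then obtain z where "z \<in> A" "g y = g x * z" by (auto simp: dvd_in_def)
      then have "y = x * h z" "h z \<in> B" using g xy hA by (metis mult, blast)
      then show "dvd_in B x y" unfolding dvd_in_def by blast
    qed
    have "irreducible_in A (g p)"
      using p irreducible_in_iso[OF h bij _ S B, of "g p"] g pB by simp
    then have "dvd_in A (g p) (g a) \<or> dvd_in A (g p) (g b)"
      using factorial_set_prime[OF A] g ab dvd dvd_iff[of p "a * b"] pB g_mult[OF ab]
        subring_mult[OF B ab] by auto
    then show ?thesis using dvd_iff pB ab by blast
  qed
  ultimately show ?thesis
    by (intro factorial_setI[OF B, of "\<lambda>b. \<delta> (g b)"]) blast+
qed

subsection \<open>Multivariate polynomials\<close>

definition mconst :: "'a::zero \<Rightarrow> ('v, 'a) mpoly" where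
  "mconst a = Poly_Mapping.single 0 a"

definition mvar :: "'v \<Rightarrow> ('v, 'a::zero_neq_one) mpoly" where
  "mvar v = Poly_Mapping.single (Poly_Mapping.single v 1) 1"

definition mon_ev :: "('v \<Rightarrow> 'b::comm_monoid_mult) \<Rightarrow> ('v \<Rightarrow>\<^sub>0 nat) \<Rightarrow> 'b" where
  "mon_ev s m = (\<Prod>v \<in> Poly_Mapping.keys m. s v ^ Poly_Mapping.lookup m v)"

text \<open>The map given by the universal property of the polynomial ring. Evaluation,
  substitution, change of coefficients and regrouping of variables are all instances of it, so that
  identities between them need checking on constants and variables only, by
  \<open>ring_morphism_eqI\<close>.\<close>

definition ev :: "('a::zero \<Rightarrow> 'b::comm_semiring_1) \<Rightarrow> ('v \<Rightarrow> 'b) \<Rightarrow> ('v, 'a) mpoly \<Rightarrow> 'b" where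
  "ev c s p = (\<Sum>m \<in> Poly_Mapping.keys p. c (Poly_Mapping.lookup p m) * mon_ev s m)"

lemma eval_mpoly_eq_ev: "eval_mpoly t = ev (\<lambda>a. a) t"
  by (auto simp: eval_mpoly_def ev_def mon_ev_def)

lemma mon_ev_superset:
  "finite W \<Longrightarrow> Poly_Mapping.keys m \<subseteq> W \<Longrightarrow> mon_ev s m = (\<Prod>v \<in> W. s v ^ Poly_Mapping.lookup m v)"
  unfolding mon_ev_def by (rule prod.mono_neutral_left) (auto simp: in_keys_iff)

lemma mon_ev_zero [simp]: "mon_ev s 0 = 1"
  by (simp add: mon_ev_def)

lemma mon_ev_add: "mon_ev s (m + m') = mon_ev s m * mon_ev s m'"
proof -
  let ?W = "Poly_Mapping.keys m \<union> Poly_Mapping.keys m'"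
  have "mon_ev s (m + m') = (\<Prod>v \<in> ?W. s v ^ Poly_Mapping.lookup (m + m') v)"
    using Poly_Mapping.keys_add[of m m'] by (intro mon_ev_superset) auto
  also have "\<dots> = mon_ev s m * mon_ev s m'"
    by (simp add: mon_ev_superset[of ?W] lookup_add power_add prod.distrib)
  finally show ?thesis .
qed

lemma mon_ev_single [simp]: "mon_ev s (Poly_Mapping.single v k) = s v ^ k"
  by (cases "k = 0") (simp_all add: mon_ev_def)

lemma ev_superset:
  "c 0 = 0 \<Longrightarrow> finite W \<Longrightarrow> Poly_Mapping.keys p \<subseteq> W \<Longrightarrow>
    ev c s p = (\<Sum>m \<in> W. c (Poly_Mapping.lookup p m) * mon_ev s m)"
  unfolding ev_def by (rule sum.mono_neutral_left) (auto simp: in_keys_iff)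

lemma ev_single: "c 0 = 0 \<Longrightarrow> ev c s (Poly_Mapping.single m a) = c a * mon_ev s m"
  by (cases "a = 0") (simp_all add: ev_def)

lemma ev_add:
  assumes "\<And>a b. c (a + b) = c a + c b" "c 0 = 0"
  shows "ev c s (p + q) = ev c s p + ev c s q"
proof -
  let ?W = "Poly_Mapping.keys p \<union> Poly_Mapping.keys q"
  have "ev c s (p + q) = (\<Sum>m \<in> ?W. c (Poly_Mapping.lookup (p + q) m) * mon_ev s m)"
    using Poly_Mapping.keys_add[of p q] assms by (intro ev_superset) auto
  also have "\<dots> = ev c s p + ev c s q"
    by (simp add: ev_superset[of c ?W] assms lookup_add algebra_simps sum.distrib)
  finally show ?thesis .
qed

lemma poly_mapping_sum_single:
  "p = (\<Sum>m \<in> Poly_Mapping.keys p. Poly_Mapping.single m (Poly_Mapping.lookup p m))"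
  by (rule poly_mapping_eqI)
    (simp add: lookup_sum lookup_single when_def in_keys_iff)

lemma poly_mapping_add_induct [case_names zero single add]:
  fixes p :: "'v \<Rightarrow>\<^sub>0 'a::comm_monoid_add"
  assumes "Q 0" "\<And>m a. Q (Poly_Mapping.single m a)" "\<And>p q. Q p \<Longrightarrow> Q q \<Longrightarrow> Q (p + q)"
  shows "Q p"
proof -
  have "Q (\<Sum>m \<in> M. Poly_Mapping.single m (Poly_Mapping.lookup p m))" for M
    by (induction M rule: infinite_finite_induct) (auto intro: assms)
  then show ?thesis by (subst poly_mapping_sum_single)
qed

lemma ring_morphism_ev:
  assumes "ring_morphism c"
  shows "ring_morphism (ev c s)"
proof
  interpret c: ring_morphism c by fact
  have add: "ev c s (p + q) = ev c s p + ev c s q" for p q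
    by (rule ev_add) (simp_all add: c.add c.zero)
  have zero: "ev c s 0 = 0" by (simp add: ev_def)
  show "ev c s (p + q) = ev c s p + ev c s q" for p q by (rule add)
  show "ev c s (p * q) = ev c s p * ev c s q" for p q
  proof (induction p rule: poly_mapping_add_induct)
    case (single m a)
    show ?case
      by (induction q rule: poly_mapping_add_induct)
        (simp_all add: zero mult_single ev_single c.zero c.mult mon_ev_add add distrib_left mult.assoc
          mult.left_commute)
  qed (simp_all add: zero add distrib_right)
  show "ev c s 1 = 1"
    using ev_single[of c s 0 1] by (simp add: c.zero c.one)
qed

lemma ring_morphism_id: "ring_morphism (\<lambda>a. a)"
  by unfold_locales auto

lemma ring_morphism_mconst: "ring_morphism (mconst :: 'a::comm_ring_1 \<Rightarrow> ('v, 'a) mpoly)"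
  by unfold_locales (auto simp: mconst_def single_add mult_single)

lemma ring_morphism_pconst: "ring_morphism (\<lambda>a::'a::comm_ring_1. [:a:])"
  by unfold_locales (auto simp: one_pCons)

lemma ev_mconst: "ring_morphism c \<Longrightarrow> ev c s (mconst a) = c a"
  by (simp add: mconst_def ev_single ring_morphism.zero)

lemma ev_mvar: "ring_morphism c \<Longrightarrow> ev c s (mvar v) = s v"
  by (simp add: mvar_def ev_single ring_morphism.zero ring_morphism.one)

lemma mvar_power: "mvar v ^ k = Poly_Mapping.single (Poly_Mapping.single v k) (1::'a::comm_ring_1)"
  by (induction k) (simp_all add: mvar_def mult_single single_add[symmetric])

lemma mon_ev_mvar: "mon_ev mvar m = Poly_Mapping.single m (1::'a::comm_ring_1)"
proof -
  have *: "(\<Prod>v \<in> W. Poly_Mapping.single (f v) (1::'a)) = Poly_Mapping.single (\<Sum>v \<in> W. f v) 1"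
    for f :: "'b \<Rightarrow> 'b \<Rightarrow>\<^sub>0 nat" and W
    by (induction W rule: infinite_finite_induct) (simp_all add: mult_single)
  show ?thesis
    unfolding mon_ev_def mvar_power * by (subst poly_mapping_sum_single[symmetric]) (rule refl)
qed

lemma single_eq_mconst_mon: "Poly_Mapping.single m a = mconst a * mon_ev mvar (m :: 'v \<Rightarrow>\<^sub>0 nat)"
  for a :: "'a::comm_ring_1"
  by (simp add: mon_ev_mvar mconst_def mult_single)

section \<open>Subrings given by a set of variables and a set of coefficients\<close>

lemma subring_UNIV: "subring_set UNIV"
  by (simp add: subring_set_def)

lemma lookup_in_mpolys: "p \<in> mpolys V A \<Longrightarrow> 0 \<in> A \<Longrightarrow> Poly_Mapping.lookup p m \<in> A"
  by (cases "m \<in> Poly_Mapping.keys p") (auto simp: mpolys_def in_keys_iff)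

lemma keys_subset_mpolys:
  "p \<in> mpolys V A \<Longrightarrow> m \<in> Poly_Mapping.keys p \<Longrightarrow> Poly_Mapping.keys m \<subseteq> V"
  by (auto simp: mpolys_def)

lemma mpolys_mono: "V \<subseteq> W \<Longrightarrow> A \<subseteq> B \<Longrightarrow> mpolys V A \<subseteq> mpolys W B"
  by (auto simp: mpolys_def)

lemma mpolys_vars_mono: "p \<in> mpolys V A \<Longrightarrow> V \<subseteq> W \<Longrightarrow> p \<in> mpolys W A"
  using mpolys_mono by blast

lemma mconst_in_mpolys: "a \<in> A \<Longrightarrow> mconst a \<in> mpolys V A"
  by (auto simp: mpolys_def mconst_def lookup_single)

lemma mvar_in_mpolys: "v \<in> V \<Longrightarrow> 1 \<in> A \<Longrightarrow> mvar v \<in> mpolys V A"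
  by (auto simp: mpolys_def mvar_def lookup_single)

lemma add_in_mpolys:
  assumes "subring_set A" "p \<in> mpolys V A" "q \<in> mpolys V A"
  shows "p + q \<in> mpolys V A"
  using assms Poly_Mapping.keys_add[of p q] lookup_in_mpolys[OF assms(2) subring_zero[OF assms(1)]]
    lookup_in_mpolys[OF assms(3) subring_zero[OF assms(1)]]
  unfolding mpolys_def by (auto simp: lookup_add intro: subring_add)

lemma mpolys_add_induct [consumes 2, case_names zero single add]:
  fixes p :: "('v, 'a::comm_monoid_add) mpoly"
  assumes "p \<in> mpolys V A" "0 \<in> A"
    and "Q 0" "\<And>m a. Poly_Mapping.keys m \<subseteq> V \<Longrightarrow> a \<in> A \<Longrightarrow> Q (Poly_Mapping.single m a)"
    and "\<And>p q. Q p \<Longrightarrow> Q q \<Longrightarrow> Q (p + q)"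
  shows "Q p"
proof -
  have "Q (\<Sum>m \<in> M. Poly_Mapping.single m (Poly_Mapping.lookup p m))"
    if "M \<subseteq> Poly_Mapping.keys p" for M
    using that
  proof (induction M rule: infinite_finite_induct)
    case (insert m M)
    then show ?case
      using assms(1,2) by (auto intro!: assms(4,5) simp: mpolys_def)
  qed (auto intro: assms)
  from this[OF order_refl] show ?thesis by (subst poly_mapping_sum_single)
qed

lemma subring_mpolys:
  assumes A: "subring_set A"
  shows "subring_set (mpolys V A)"
  unfolding subring_set_def
proof (intro conjI ballI)
  note A0 = subring_zero[OF A]
  show zero: "0 \<in> mpolys V A" and one: "1 \<in> mpolys V A"
    using subring_one[OF A] by (auto simp: mpolys_def lookup_one)
  fix p assume p: "p \<in> mpolys V A"
  show "- p \<in> mpolys V A"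
    using p A by (auto simp: mpolys_def in_keys_iff subring_uminus)
  fix q assume q: "q \<in> mpolys V A"
  show "p + q \<in> mpolys V A" using A p q by (rule add_in_mpolys)
  show "p * q \<in> mpolys V A" using p A0
  proof (induction rule: mpolys_add_induct)
    case (single m a)
    from q A0 show ?case
    proof (induction rule: mpolys_add_induct)
      case (single m' b)
      then show ?case
        using \<open>a \<in> A\<close> \<open>Poly_Mapping.keys m \<subseteq> V\<close> subring_mult[OF A] Poly_Mapping.keys_add[of m m']
        by (auto simp: mult_single mpolys_def lookup_single when_def)
    qed (auto simp: zero distrib_left intro: add_in_mpolys[OF A])
  qed (auto simp: zero distrib_right intro: add_in_mpolys[OF A])
qed

lemma mpolys_induct [consumes 2, case_names const var add mult]:
  assumes "p \<in> mpolys V A" "subring_set A"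
    and const: "\<And>a. a \<in> A \<Longrightarrow> Q (mconst a)" and var: "\<And>v. v \<in> V \<Longrightarrow> Q (mvar v)"
    and add: "\<And>p q. Q p \<Longrightarrow> Q q \<Longrightarrow> Q (p + q)" and mult: "\<And>p q. Q p \<Longrightarrow> Q q \<Longrightarrow> Q (p * q)"
  shows "Q p"
  using assms(1) subring_zero[OF assms(2)]
proof (induction rule: mpolys_add_induct)
  case zero
  then show ?case using const[OF subring_zero[OF assms(2)]] by (simp add: mconst_def)
next
  case (single m a)
  have one: "Q 1" using const[OF subring_one[OF assms(2)]] by (simp add: mconst_def)
  have "Q (mvar v ^ k)" if "v \<in> V" for v k
    by (induction k) (auto intro: one mult var that)
  then have "Q (\<Prod>v \<in> W. mvar v ^ Poly_Mapping.lookup m v)" if "W \<subseteq> V" for W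
    using that by (induction W rule: infinite_finite_induct) (auto intro: one mult)
  then have "Q (mon_ev mvar m)" using single by (auto simp: mon_ev_def)
  then show ?case unfolding single_eq_mconst_mon using single by (intro mult const)
qed (rule add)

lemma ring_morphism_in_subring:
  assumes "ring_morphism f" "subring_set A" "subring_set B" "p \<in> mpolys V A"
    and "\<And>a. a \<in> A \<Longrightarrow> f (mconst a) \<in> B" "\<And>v. v \<in> V \<Longrightarrow> f (mvar v) \<in> B"
  shows "f p \<in> B"
  using assms(4,2)
proof (induction rule: mpolys_induct)
  case (add p q)
  then show ?case using assms by (simp add: ring_morphism.add subring_add)
next
  case (mult p q)
  then show ?case using assms by (simp add: ring_morphism.mult subring_mult)
qed (use assms in auto)

lemma ring_morphism_eqI:
  assumes "ring_morphism f" "ring_morphism g" "subring_set A" "p \<in> mpolys V A"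
    and "\<And>a. a \<in> A \<Longrightarrow> f (mconst a) = g (mconst a)" "\<And>v. v \<in> V \<Longrightarrow> f (mvar v) = g (mvar v)"
  shows "f p = g p"
  using assms(4,3)
  by (induction rule: mpolys_induct)
    (simp_all add: assms ring_morphism.add[OF assms(1)] ring_morphism.add[OF assms(2)]
      ring_morphism.mult[OF assms(1)] ring_morphism.mult[OF assms(2)])

lemma mpolys_UNIV [simp]: "p \<in> mpolys UNIV UNIV"
  by (simp add: mpolys_def)

lemma mpolys_empty: "mpolys {} A = mconst ` A" if "0 \<in> A"
proof (intro equalityI subsetI)
  fix p :: "('v, 'a) mpoly" assume p: "p \<in> mpolys {} A"
  then have "p = mconst (Poly_Mapping.lookup p 0)"
    by (intro poly_mapping_eqI) (auto simp: mconst_def lookup_single when_def mpolys_def in_keys_iff)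
  moreover have "Poly_Mapping.lookup p 0 \<in> A"
    using p that by (rule lookup_in_mpolys)
  ultimately show "p \<in> mconst ` A" by blast
qed (auto intro: mconst_in_mpolys)

text \<open>The isomorphism from K[V, v] to K[V][v]. It is inverse to evaluation at
  \<open>mvar v\<close>, and the coefficients keep the multivariate type.\<close>

definition as_upoly :: "'v \<Rightarrow> ('v, 'a::comm_ring_1) mpoly \<Rightarrow> ('v, 'a) mpoly poly" where
  "as_upoly v = ev (\<lambda>a. [:mconst a:]) (\<lambda>u. if u = v then [:0, 1:] else [:mvar u:])"

lemma ring_morphism_as_upoly: "ring_morphism (as_upoly v)"
  unfolding as_upoly_def
  by (intro ring_morphism_ev ring_morphism_comp[OF ring_morphism_pconst ring_morphism_mconst])

lemma as_upoly_mconst [simp]: "as_upoly v (mconst a) = [:mconst a:]"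
  and as_upoly_mvar [simp]: "as_upoly v (mvar u) = (if u = v then [:0, 1:] else [:mvar u:])"
  unfolding as_upoly_def
  by (simp_all add: ev_mconst ev_mvar ring_morphism_comp[OF ring_morphism_pconst ring_morphism_mconst])

lemma as_upoly_const: "as_upoly v p = [:p:]" if "p \<in> mpolys V UNIV" "v \<notin> V"
  by (rule ring_morphism_eqI[OF ring_morphism_as_upoly ring_morphism_pconst subring_UNIV that(1)])
    (use that in auto)

lemma ring_morphism_poly: "ring_morphism (\<lambda>P. poly P x)"
  by unfold_locales auto

lemma poly_as_upoly: "poly (as_upoly v p) (mvar v) = p"
  by (rule ring_morphism_eqI[OF ring_morphism_comp[OF ring_morphism_poly ring_morphism_as_upoly]
        ring_morphism_id subring_UNIV mpolys_UNIV]) auto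

lemma as_upoly_eq_0_iff: "as_upoly v p = 0 \<longleftrightarrow> p = 0"
  using poly_as_upoly[of v p] ring_morphism.zero[OF ring_morphism_as_upoly, of v] by auto

lemma as_upoly_in_polys_over:
  assumes "p \<in> mpolys V UNIV" "V \<subseteq> insert v W"
  shows "as_upoly v p \<in> polys_over (mpolys W UNIV)"
proof (rule ring_morphism_in_subring[OF ring_morphism_as_upoly subring_UNIV
      subring_polys_over[OF subring_mpolys[OF subring_UNIV]] assms(1)])
  note [simp] = subring_mpolys[OF subring_UNIV]
  show "as_upoly v (mvar u) \<in> polys_over (mpolys W UNIV)" if "u \<in> V" for u
    using assms(2) that subring_zero[OF subring_polys_over[OF subring_mpolys[OF subring_UNIV]]]
    by (auto simp: pCons_in_polys_over mvar_in_mpolys subring_zero subring_one)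
qed (simp add: const_in_polys_over mconst_in_mpolys subring_mpolys[OF subring_UNIV])

lemma as_upoly_poly_mvar:
  assumes "P \<in> polys_over (mpolys V UNIV)" "v \<notin> V"
  shows "as_upoly v (poly P (mvar v)) = P"
proof -
  have "as_upoly v (poly P (mvar v)) = poly (map_poly (as_upoly v) P) [:0, 1:]"
    by (subst ring_morphism.poly[OF ring_morphism_as_upoly]) simp
  also have "map_poly (as_upoly v) P = map_poly (\<lambda>c. [:c:]) P"
    using assms by (intro poly_eqI)
      (simp add: coeff_map_poly ring_morphism.zero[OF ring_morphism_as_upoly] polys_over_def
        as_upoly_const[of _ V])
  also have "poly \<dots> [:0, 1:] = P"
    by (simp add: pcompose_altdef[symmetric])
  finally show ?thesis .
qed

lemma bij_betw_poly_mvar: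
  assumes "v \<notin> V"
  shows "bij_betw (\<lambda>P. poly P (mvar v)) (polys_over (mpolys V UNIV))
    (mpolys (insert v V) (UNIV :: 'a::comm_ring_1 set))"
proof (rule bij_betw_byWitness[where f' = "as_upoly v"])
  note S = subring_mpolys[OF subring_UNIV, of "insert v V", where 'a = 'a]
  show "(\<lambda>P. poly P (mvar v)) ` polys_over (mpolys V UNIV) \<subseteq>
    mpolys (insert v V) (UNIV :: 'a set)"
  proof (rule image_subsetI)
    fix P assume "P \<in> polys_over (mpolys V (UNIV :: 'a set))"
    then show "poly P (mvar v) \<in> mpolys (insert v V) UNIV"
    proof (induction P)
      case (pCons a P)
      then have "a \<in> mpolys (insert v V) UNIV"
        using mpolys_mono[of V "insert v V" UNIV UNIV] by (auto simp: pCons_in_polys_over)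
      then show ?case using pCons S
        by (auto simp: pCons_in_polys_over intro!: subring_add subring_mult mvar_in_mpolys)
    qed (use subring_zero[OF S] in simp)
  qed
qed (use assms in \<open>auto simp: poly_as_upoly as_upoly_poly_mvar intro: as_upoly_in_polys_over\<close>)

lemma polys_Suc: "mpolys {..<Suc n} A = mpolys (insert n {..<n}) A"
  by (simp add: lessThan_Suc)

lemma subring_polys: "subring_set (polys n)"
  by (rule subring_mpolys[OF subring_UNIV])

lemma polys_y_eq: "polys_y n = polys_over (polys n)"
  by (simp add: polys_y_def polys_over_def)

lemma mconst_mult: "mconst (a * b) = mconst a * (mconst b :: ('v, 'a::comm_ring_1) mpoly)"
  by (rule ring_morphism.mult[OF ring_morphism_mconst])

lemma mconst_1 [simp]: "mconst (1::'a::comm_ring_1) = 1"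
  by (rule ring_morphism.one[OF ring_morphism_mconst])

lemma mconst_0 [simp]: "mconst 0 = 0"
  by (simp add: mconst_def)

lemma mconst_eq_iff [simp]: "mconst a = mconst b \<longleftrightarrow> a = b"
  by (metis lookup_single_eq mconst_def)

lemma mconst_eq_0_iff [simp]: "mconst a = 0 \<longleftrightarrow> a = 0"
  by (metis mconst_0 mconst_eq_iff)

lemma unit_in_polys_iff: "unit_in (polys n) p \<longleftrightarrow> (\<exists>a. a \<noteq> (0::'k::field) \<and> p = mconst a)"
proof
  assume "\<exists>a. a \<noteq> 0 \<and> p = mconst a"
  then obtain a where a: "a \<noteq> 0" "p = mconst a" by blast
  then have "p * mconst (inverse a) = 1" by (simp add: mconst_mult[symmetric])
  then show "unit_in (polys n) p"
    using a unfolding unit_in_def by (metis UNIV_I mconst_in_mpolys)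
next
  show "\<exists>a. a \<noteq> 0 \<and> p = mconst a" if "unit_in (polys n) p"
    using that
  proof (induction n arbitrary: p)
    case 0
    then have p: "p \<in> mpolys {} UNIV" "p \<noteq> 0" by (auto simp: unit_in_def)
    then obtain a where "p = mconst a" by (auto simp: mpolys_empty)
    then show ?case using p by auto
  next
    case (Suc n)
    let ?h = "\<lambda>P. poly P (mvar n)"
    have bij: "bij_betw ?h (polys_over (polys n)) (polys (Suc n) :: (nat, 'k) mpoly set)"
      unfolding polys_Suc by (rule bij_betw_poly_mvar) simp
    obtain P where P: "P \<in> polys_over (polys n)" "p = poly P (mvar n)"
      using Suc.prems bij by (auto simp: unit_in_def bij_betw_def)
    then have "unit_in (polys_over (polys n)) P"
      using Suc.prems unit_in_iso[OF ring_morphism_poly bij P(1) subring_polys_over[OF subring_polys]]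
      by simp
    then obtain q where "unit_in (polys n) q" "P = [:q:]"
      by (auto simp: unit_in_polys_over_iff[OF subring_polys])
    then show ?case using Suc.IH P by auto
  qed
qed

lemma factorial_set_polys: "factorial_set (polys n :: (nat, 'k::field) mpoly set)"
proof (induction n)
  case 0
  have unit: "unit_in (polys 0) p" if p: "p \<in> polys 0" "p \<noteq> 0" for p :: "(nat, 'k) mpoly"
  proof -
    obtain a where "p = mconst a" using p(1) by (auto simp: mpolys_empty)
    then show ?thesis using p(2) unfolding unit_in_polys_iff by auto
  qed
  have no_irr: "\<not> irreducible_in (polys 0) p" for p :: "(nat, 'k) mpoly"
    unfolding irreducible_in_iff[OF subring_polys] using unit by blast
  show ?case
    \<comment> \<open>In a field every nonzero element is a unit, so \<open>\<delta>\<close> may be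
      0, and there are no irreducible elements to be shown prime.\<close>
    by (rule factorial_setI[OF subring_polys, of _ "\<lambda>_. 0"])
      (use unit no_irr in auto)
next
  case (Suc n)
  show ?case unfolding polys_Suc
    by (rule factorial_set_iso[OF ring_morphism_poly bij_betw_poly_mvar
          factorial_set_polys_over[OF Suc] subring_mpolys[OF subring_UNIV]]) simp
qed

lemma irreducible_in_polys_Suc:
  fixes P :: "(nat, 'k::field) mpoly poly"
  assumes "P \<in> polys_over (polys n)"
  shows "irreducible_in (polys (Suc n)) (poly P (mvar n)) \<longleftrightarrow> irreducible_in (polys_over (polys n)) P"
  unfolding polys_Suc
  by (rule irreducible_in_iso[OF ring_morphism_poly bij_betw_poly_mvar assms
        subring_polys_over[OF subring_polys] subring_mpolys[OF subring_UNIV]]) simp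

lemma irreducible_in_polys_mono:
  assumes "irreducible_in (polys n) (p :: (nat, 'k::field) mpoly)" "n \<le> m"
  shows "irreducible_in (polys m) p"
  using assms(2)
proof (induction rule: dec_induct)
  case (step m)
  have "[:p:] \<in> polys_over (polys m)"
    using step by (simp add: const_in_polys_over[OF subring_polys] irreducible_in_def)
  then show ?case
    using irreducible_in_polys_Suc[of "[:p:]" m] step
    by (simp add: irreducible_in_const_polys_over[OF subring_polys])
qed (rule assms)

subsection \<open>Substitutions\<close>

abbreviation msubst :: "('v \<Rightarrow> ('w, 'a::comm_ring_1) mpoly) \<Rightarrow> ('v, 'a) mpoly \<Rightarrow> ('w, 'a) mpoly" where
  "msubst \<equiv> ev mconst"

lemma ring_morphism_msubst: "ring_morphism (msubst s)"
  by (rule ring_morphism_ev[OF ring_morphism_mconst])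

lemma msubst_mconst [simp]: "msubst s (mconst a) = mconst a"
  and msubst_mvar [simp]: "msubst s (mvar v) = s v"
  by (simp_all add: ev_mconst ev_mvar ring_morphism_mconst)

lemma ring_morphism_eval_mpoly:
  "ring_morphism (eval_mpoly (t :: 'v \<Rightarrow> 'a::comm_ring_1) :: ('v, 'a) mpoly \<Rightarrow> 'a)"
  unfolding eval_mpoly_eq_ev by (rule ring_morphism_ev[OF ring_morphism_id])

lemma eval_mpoly_mconst [simp]: "eval_mpoly t (mconst (a :: 'a::comm_ring_1)) = a"
  and eval_mpoly_mvar [simp]: "eval_mpoly t (mvar v :: ('v, 'a) mpoly) = t v"
  by (simp_all add: eval_mpoly_eq_ev ev_mconst ev_mvar ring_morphism_id)

lemma msubst_in_mpolys:
  "p \<in> mpolys V UNIV \<Longrightarrow> (\<And>v. v \<in> V \<Longrightarrow> s v \<in> mpolys W UNIV) \<Longrightarrow> msubst s p \<in> mpolys W UNIV"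
  by (rule ring_morphism_in_subring[OF ring_morphism_msubst subring_UNIV subring_mpolys[OF subring_UNIV]])
    (auto intro: mconst_in_mpolys)

lemma msubst_cong:
  "p \<in> mpolys V UNIV \<Longrightarrow> (\<And>v. v \<in> V \<Longrightarrow> s v = s' v) \<Longrightarrow> msubst s p = msubst s' p"
  by (rule ring_morphism_eqI[OF ring_morphism_msubst ring_morphism_msubst subring_UNIV]) auto

lemma msubst_msubst: "msubst s (msubst s' p) = msubst (\<lambda>v. msubst s (s' v)) p"
  by (rule ring_morphism_eqI[OF ring_morphism_comp[OF ring_morphism_msubst ring_morphism_msubst]
        ring_morphism_msubst subring_UNIV mpolys_UNIV]) auto

lemma msubst_id: "p \<in> mpolys V UNIV \<Longrightarrow> (\<And>v. v \<in> V \<Longrightarrow> s v = mvar v) \<Longrightarrow> msubst s p = p"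
  by (rule ring_morphism_eqI[OF ring_morphism_msubst ring_morphism_id subring_UNIV]) auto

lemma bij_betw_msubst:
  assumes "\<And>v. v \<in> V \<Longrightarrow> s v \<in> mpolys W UNIV" "\<And>v. v \<in> W \<Longrightarrow> s' v \<in> mpolys V UNIV"
    and "\<And>v. v \<in> V \<Longrightarrow> msubst s' (s v) = mvar v" "\<And>v. v \<in> W \<Longrightarrow> msubst s (s' v) = mvar v"
  shows "bij_betw (msubst s) (mpolys V UNIV) (mpolys W UNIV)"
  by (rule bij_betw_byWitness[where f' = "msubst s'"])
    (auto simp: msubst_msubst msubst_id[of _ V] msubst_id[of _ W] assms intro: msubst_in_mpolys)

text \<open>The shifts involve unshifted variables only, so both the substitution and the one with
  opposite signs leave them alone, and the two are inverse to each other.\<close>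

lemma bij_betw_shear:
  fixes s :: "'v \<Rightarrow> ('v, 'a::comm_ring_1) mpoly"
  assumes "W \<subseteq> V" and s: "\<And>v. v \<in> W \<Longrightarrow> s v \<in> mpolys (V - W) UNIV"
  shows "bij_betw (msubst (\<lambda>v. if v \<in> W then mvar v + s v else mvar v)) (mpolys V UNIV) (mpolys V UNIV)"
proof (rule bij_betw_msubst[where s' = "\<lambda>v. if v \<in> W then mvar v - s v else mvar v"])
  note S = subring_mpolys[OF subring_UNIV, of V, where 'a = 'a]
  have sV: "s v \<in> mpolys V UNIV" if "v \<in> W" for v
    using s[OF that] mpolys_mono[of "V - W" V UNIV UNIV] by auto
  have fix_s: "msubst s' (s v) = s v"
    if "v \<in> W" "\<And>u. u \<notin> W \<Longrightarrow> s' u = mvar u" for v and s' :: "'v \<Rightarrow> ('v, 'a) mpoly"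
    using s[OF that(1)] by (rule msubst_id) (use that in auto)
  show "(if v \<in> W then mvar v + s v else mvar v) \<in> mpolys V UNIV"
    "(if v \<in> W then mvar v - s v else mvar v) \<in> mpolys V UNIV" if "v \<in> V" for v
    using that sV S by (auto intro: subring_add subring_diff mvar_in_mpolys)
  show "msubst (\<lambda>v. if v \<in> W then mvar v - s v else mvar v) (if v \<in> W then mvar v + s v else mvar v) =
    mvar v" if "v \<in> V" for v
    by (simp add: ring_morphism.add[OF ring_morphism_msubst] fix_s)
  show "msubst (\<lambda>v. if v \<in> W then mvar v + s v else mvar v) (if v \<in> W then mvar v - s v else mvar v) =
    mvar v" if "v \<in> V" for v
    by (simp add: ring_morphism.diff[OF ring_morphism_msubst] fix_s)
qed

lemma bij_betw_reversal:
  assumes "\<And>v. v \<in> V \<Longrightarrow> f v \<in> V" "\<And>v. v \<in> V \<Longrightarrow> f (f v) = v"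
  shows "bij_betw (msubst (\<lambda>v. mvar (f v))) (mpolys V UNIV) (mpolys V UNIV)"
  by (rule bij_betw_msubst[where s' = "\<lambda>v. mvar (f v)"]) (auto simp: assms mvar_in_mpolys)

section \<open>Changing coefficients, and separating parameters from unknowns\<close>

definition cmap :: "('a::zero \<Rightarrow> 'b::comm_ring_1) \<Rightarrow> ('v, 'a) mpoly \<Rightarrow> ('v, 'b) mpoly" where
  "cmap h = ev (\<lambda>a. mconst (h a)) mvar"

lemma ring_morphism_cmap: "ring_morphism h \<Longrightarrow> ring_morphism (cmap h)"
  unfolding cmap_def by (intro ring_morphism_ev ring_morphism_comp[OF ring_morphism_mconst])

lemma cmap_mconst: "ring_morphism h \<Longrightarrow> cmap h (mconst a) = mconst (h a)"
  and cmap_mvar: "ring_morphism h \<Longrightarrow> cmap h (mvar v) = mvar v"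
  unfolding cmap_def by (simp_all add: ev_mconst ev_mvar ring_morphism_comp[OF ring_morphism_mconst])

lemma lookup_cmap:
  assumes "ring_morphism h"
  shows "Poly_Mapping.lookup (cmap h p) m = h (Poly_Mapping.lookup p m)"
proof -
  interpret ring_morphism h by fact
  show ?thesis
    unfolding cmap_def ev_def single_eq_mconst_mon[symmetric]
    by (simp add: lookup_sum lookup_single when_def in_keys_iff zero)
qed

lemma ring_morphism_to_fract: "ring_morphism to_fract"
  by unfold_locales auto

text \<open>The isomorphism from K[\<lambda>, x] to K[\<lambda>][x]. The unknowns are renumbered
  from 0, as Hilbert data require, while the parameters keep their numbers.\<close>

definition split_vars :: "nat \<Rightarrow> (nat, 'a::comm_ring_1) mpoly \<Rightarrow> (nat, (nat, 'a) mpoly) mpoly" where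
  "split_vars r = ev (\<lambda>a. mconst (mconst a)) (\<lambda>v. if v < r then mconst (mvar v) else mvar (v - r))"

lemma ring_morphism_split_vars: "ring_morphism (split_vars r)"
  unfolding split_vars_def
  by (intro ring_morphism_ev ring_morphism_comp[OF ring_morphism_mconst ring_morphism_mconst])

lemma split_vars_mconst [simp]: "split_vars r (mconst a) = mconst (mconst a)"
  and split_vars_mvar [simp]: "split_vars r (mvar v) = (if v < r then mconst (mvar v) else mvar (v - r))"
  unfolding split_vars_def
  by (simp_all add: ev_mconst ev_mvar ring_morphism_comp[OF ring_morphism_mconst ring_morphism_mconst])

lemma split_vars_polys: "split_vars r c = mconst c" if "c \<in> mpolys {..<r} UNIV"
  by (rule ring_morphism_eqI[OF ring_morphism_split_vars ring_morphism_mconst subring_UNIV that]) auto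

lemma bij_betw_split_vars:
  "bij_betw (split_vars r) (mpolys {..<r + n} UNIV)
    (mpolys {..<n} (mpolys {..<r} (UNIV :: 'a::comm_ring_1 set)))"
proof -
  let ?u = "ev (\<lambda>a::(nat, 'a) mpoly. a) (\<lambda>i. mvar (r + i))"
  note S = subring_mpolys[OF subring_UNIV, of "{..<r}", where 'a = 'a]
  note u = ring_morphism_ev[OF ring_morphism_id[where 'a = "(nat, 'a) mpoly"], of "\<lambda>i. mvar (r + i)"]
  have u_simps [simp]: "?u (mconst a) = a" "?u (mvar i) = mvar (r + i)" for a and i :: nat
    by (simp_all add: ev_mconst ev_mvar ring_morphism_id)
  have "?u (split_vars r p) = p" for p :: "(nat, 'a) mpoly"
    by (rule ring_morphism_eqI[OF ring_morphism_comp[OF u ring_morphism_split_vars]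
          ring_morphism_id subring_UNIV mpolys_UNIV]) auto
  moreover have "split_vars r (?u q) = q" if "q \<in> mpolys {..<n} (mpolys {..<r} UNIV)"
    for q :: "(nat, (nat, 'a) mpoly) mpoly"
    by (rule ring_morphism_eqI[OF ring_morphism_comp[OF ring_morphism_split_vars u]
          ring_morphism_id S that]) (auto simp: split_vars_polys)
  moreover have "split_vars r p \<in> mpolys {..<n} (mpolys {..<r} UNIV)" if "p \<in> mpolys {..<r + n} UNIV"
    for p :: "(nat, 'a) mpoly"
    by (rule ring_morphism_in_subring[OF ring_morphism_split_vars subring_UNIV subring_mpolys[OF S] that])
      (auto intro!: mconst_in_mpolys mvar_in_mpolys subring_one[OF S])
  moreover have "?u q \<in> mpolys {..<r + n} UNIV" if "q \<in> mpolys {..<n} (mpolys {..<r} UNIV)"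
    for q :: "(nat, (nat, 'a) mpoly) mpoly"
    by (rule ring_morphism_in_subring[OF u S subring_mpolys[OF subring_UNIV] that])
      (auto intro: mvar_in_mpolys subsetD[OF mpolys_mono[of "{..<r}" "{..<r + n}" UNIV UNIV]])
  ultimately show ?thesis
    by (intro bij_betw_byWitness[where f' = ?u]) auto
qed

section \<open>From polynomial to rational coefficients\<close>

lemma subring_ratfuns: "subring_set (ratfuns r :: (nat, 'k::field) mpoly fract set)"
proof -
  note S = subring_polys[of r, where 'a = 'k]
  have I: "Fract a b \<in> ratfuns r" if "a \<in> polys r" "b \<in> polys r" "b \<noteq> 0" for a b :: "(nat, 'k) mpoly"
    using that by (auto simp: ratfuns_def)
  have "(0 :: (nat, 'k) mpoly fract) \<in> ratfuns r" "(1 :: (nat, 'k) mpoly fract) \<in> ratfuns r"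
    using I[OF subring_zero[OF S] subring_one[OF S]] I[OF subring_one[OF S] subring_one[OF S]]
    by (auto simp: Zero_fract_def One_fract_def)
  moreover have "x + y \<in> ratfuns r \<and> x * y \<in> ratfuns r" if xy: "x \<in> ratfuns r" "y \<in> ratfuns r"
    for x y :: "(nat, 'k) mpoly fract"
  proof -
    obtain a b a' b' where "x = Fract a b" "a \<in> polys r" "b \<in> polys r" "b \<noteq> 0"
      "y = Fract a' b'" "a' \<in> polys r" "b' \<in> polys r" "b' \<noteq> 0"
      using xy by (auto simp: ratfuns_def)
    then show ?thesis using S by (auto intro!: I subring_add subring_mult)
  qed
  moreover have "- x \<in> ratfuns r" if x: "x \<in> ratfuns r" for x :: "(nat, 'k) mpoly fract"
  proof -
    obtain a b where "x = Fract a b" "a \<in> polys r" "b \<in> polys r" "b \<noteq> 0"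
      using x by (auto simp: ratfuns_def)
    then show ?thesis using S by (auto intro!: I subring_uminus)
  qed
  ultimately show ?thesis by (simp add: subring_set_def)
qed

lemma to_fract_in_ratfuns: "a \<in> polys r \<Longrightarrow> to_fract a \<in> ratfuns r"
  using subring_one[OF subring_polys] by (force simp: ratfuns_def to_fract_def)

lemma inverse_to_fract_in_ratfuns: "a \<in> polys r \<Longrightarrow> a \<noteq> 0 \<Longrightarrow> inverse (to_fract a) \<in> ratfuns r"
  using subring_one[OF subring_polys] by (force simp: ratfuns_def to_fract_def)

lemma clear_denominators:
  fixes G :: "(nat, (nat, 'k::field) mpoly fract) mpoly"
  assumes "G \<in> mpolys V (ratfuns r)"
  shows "\<exists>c G'. c \<in> polys r \<and> c \<noteq> 0 \<and> G' \<in> mpolys V (polys r) \<and>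
    mconst (to_fract c) * G = cmap to_fract G'"
  using assms subring_zero[OF subring_ratfuns]
proof (induction rule: mpolys_add_induct)
  case zero
  show ?case
    using subring_one[OF subring_polys] subring_zero[OF subring_mpolys[OF subring_polys]]
    by (intro exI[of _ 1] exI[of _ 0])
      (auto simp: ring_morphism.zero[OF ring_morphism_cmap[OF ring_morphism_to_fract]])
next
  case (single m a)
  then obtain x y where xy: "a = Fract x y" "x \<in> polys r" "y \<in> polys r" "y \<noteq> 0"
    by (auto simp: ratfuns_def)
  have "Poly_Mapping.single m x \<in> mpolys V (polys r)"
    using single xy by (auto simp: mpolys_def lookup_single)
  moreover have "mconst (to_fract y) * Poly_Mapping.single m a = cmap to_fract (Poly_Mapping.single m x)"
    using xy by (intro poly_mapping_eqI)
      (simp add: lookup_cmap[OF ring_morphism_to_fract] mconst_def mult_single lookup_single when_def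
        to_fract_def eq_fract mult.commute
        Zero_fract_def[symmetric])
  ultimately show ?case using xy by blast
next
  case (add G H)
  then obtain c G' d H' where *: "c \<in> polys r" "c \<noteq> 0" "G' \<in> mpolys V (polys r)"
    "mconst (to_fract c) * G = cmap to_fract G'"
    "d \<in> polys r" "d \<noteq> 0" "H' \<in> mpolys V (polys r)"
    "mconst (to_fract d) * H = cmap to_fract H'"
    by metis
  interpret ring_morphism "cmap to_fract :: (nat, (nat, 'k) mpoly) mpoly \<Rightarrow> _"
    by (rule ring_morphism_cmap[OF ring_morphism_to_fract])
  have "mconst (to_fract (c * d)) * (G + H) =
    mconst (to_fract d) * (mconst (to_fract c) * G) + mconst (to_fract c) * (mconst (to_fract d) * H)"
    by (simp add: mconst_mult algebra_simps)
  also have "\<dots> = cmap to_fract (mconst d * G' + mconst c * H')"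
    by (simp add: * add mult cmap_mconst[OF ring_morphism_to_fract])
  finally show ?case
    using * subring_mpolys[OF subring_polys[where 'a = 'k], of V]
    by (intro exI[of _ "c * d"] exI[of _ "mconst d * G' + mconst c * H'"])
      (auto intro!: subring_mult[OF subring_polys] subring_add subring_mult mconst_in_mpolys)
qed

text \<open>Clearing denominators in a factorization \<open>G * H\<close> over the rational
  functions gives \<open>c * d * f = G' * H'\<close> with polynomial coefficients. There
  \<open>f\<close> is prime and divides, say, \<open>G'\<close>; then \<open>H'\<close> divides
  \<open>c * d\<close> and \<open>H\<close> is a unit. The assumption \<open>ndvd\<close> keeps
  \<open>f\<close> from becoming a unit itself.\<close>

lemma irreducible_in_over_ratfuns:
  fixes F :: "(nat, 'k::field) mpoly"
  assumes F: "irreducible_in (polys (r + n)) F"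
    and ndvd: "\<And>c. c \<in> polys r \<Longrightarrow> c \<noteq> 0 \<Longrightarrow> \<not> dvd_in (polys (r + n)) F c"
  shows "irreducible_in (mpolys {..<n} (ratfuns r)) (cmap to_fract (split_vars r F))"
proof -
  define S where "S = mpolys {..<n} (polys r :: (nat, 'k) mpoly set)"
  define Q where "Q = mpolys {..<n} (ratfuns r :: (nat, 'k) mpoly fract set)"
  define f where "f = split_vars r F"
  define \<iota> where "\<iota> = (cmap to_fract :: (nat, (nat, 'k) mpoly) mpoly \<Rightarrow> _)"
  have SS: "subring_set S" unfolding S_def by (rule subring_mpolys[OF subring_polys])
  have SQ: "subring_set Q" unfolding Q_def by (rule subring_mpolys[OF subring_ratfuns])
  interpret \<iota>: ring_morphism \<iota>
    unfolding \<iota>_def by (rule ring_morphism_cmap[OF ring_morphism_to_fract])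
  have \<iota>_const: "\<iota> (mconst c) = mconst (to_fract c)" for c
    unfolding \<iota>_def by (rule cmap_mconst[OF ring_morphism_to_fract])
  have \<iota>_var: "\<iota> (mvar i) = mvar i" for i
    unfolding \<iota>_def by (rule cmap_mvar[OF ring_morphism_to_fract])
  have \<iota>_inj: "p = q" if "\<iota> p = \<iota> q" for p q
  proof (rule poly_mapping_eqI)
    fix m
    have "to_fract (Poly_Mapping.lookup p m) = to_fract (Poly_Mapping.lookup q m)"
      using that unfolding \<iota>_def by (metis lookup_cmap[OF ring_morphism_to_fract])
    then show "Poly_Mapping.lookup p m = Poly_Mapping.lookup q m" by simp
  qed
  have \<iota>_Q: "\<iota> p \<in> Q" if "p \<in> S" for p
    using that unfolding Q_def
  proof -
    show "\<iota> p \<in> mpolys {..<n} (ratfuns r)"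
      by (rule ring_morphism_in_subring[OF \<iota>.ring_morphism_axioms subring_polys
            SQ[unfolded Q_def] that[unfolded S_def]])
        (auto simp: \<iota>_const \<iota>_var
          intro!: mconst_in_mpolys to_fract_in_ratfuns mvar_in_mpolys subring_one[OF subring_ratfuns])
  qed
  have bij: "bij_betw (split_vars r) (polys (r + n) :: (nat, 'k) mpoly set) S"
    unfolding S_def by (rule bij_betw_split_vars)
  have FA: "F \<in> polys (r + n)" using F by (simp add: irreducible_in_def)
  have factS: "factorial_set S"
    by (rule factorial_set_iso[OF ring_morphism_split_vars bij factorial_set_polys SS])
  have f: "irreducible_in S f"
    unfolding f_def using irreducible_in_iso[OF ring_morphism_split_vars bij FA subring_polys SS] F by simp
  then have f0: "f \<in> S" "f \<noteq> 0" by (auto simp: irreducible_in_iff[OF SS])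
  have not_dvd: "f * q \<noteq> mconst c" if "c \<in> polys r" "c \<noteq> 0" "q \<in> S" for c q
  proof
    assume eq: "f * q = mconst c"
    obtain G where G: "G \<in> polys (r + n)" "q = split_vars r G"
      using bij \<open>q \<in> S\<close> by (auto simp: bij_betw_def)
    have "split_vars r (F * G) = split_vars r c"
      using eq G that by (simp add: f_def ring_morphism.mult[OF ring_morphism_split_vars] split_vars_polys)
    moreover have "F * G \<in> polys (r + n)" "c \<in> polys (r + n)"
      using FA G that subring_mult[OF subring_polys] mpolys_mono[of "{..<r}" "{..<r + n}" UNIV UNIV]
      by auto
    ultimately have "c = F * G" using bij by (auto simp: bij_betw_def dest: inj_onD)
    then show False using ndvd[of c] that(1,2) G(1) unfolding dvd_in_def by blast
  qed
  have main: "unit_in Q H"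
    if asm: "c \<in> polys r" "c \<noteq> 0" "d \<in> polys r" "d \<noteq> 0" "H \<in> Q" "H' \<in> S" "G' \<in> S"
      "mconst (to_fract d) * H = \<iota> H'" "mconst (c * d) * f = G' * H'" "dvd_in S f G'"
    for c d G' H H'
  proof -
    obtain k where k: "k \<in> S" "G' = f * k" using asm by (auto simp: dvd_in_def)
    have "f * mconst (c * d) = f * (k * H')"
      using asm(9) unfolding k(2) by (simp only: ac_simps)
    then have "mconst (c * d) = k * H'" using f0 by (metis mult_left_cancel)
    then have "mconst (to_fract (c * d)) = \<iota> k * \<iota> H'" by (metis \<iota>.mult \<iota>_const)
    then have eq: "mconst (to_fract (c * d)) = H * (\<iota> k * mconst (to_fract d))"
      unfolding asm(8)[symmetric] by (simp only: ac_simps)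
    have cd: "c * d \<in> polys r" "c * d \<noteq> 0" using asm subring_mult[OF subring_polys] by auto
    let ?i = "mconst (inverse (to_fract (c * d)))"
    have "H * (\<iota> k * mconst (to_fract d) * ?i) = mconst (to_fract (c * d)) * ?i"
      unfolding eq by (simp only: ac_simps)
    also have "\<dots> = 1"
      unfolding mconst_mult[symmetric] using cd by (simp del: to_fract_mult)
    finally have "H * (\<iota> k * mconst (to_fract d) * ?i) = 1" .
    moreover have "mconst (to_fract d) \<in> Q" "?i \<in> Q"
      unfolding Q_def using asm(3) cd
      by (blast intro: mconst_in_mpolys to_fract_in_ratfuns inverse_to_fract_in_ratfuns)+
    then have "\<iota> k * mconst (to_fract d) * ?i \<in> Q"
      using \<iota>_Q[OF k(1)] by (intro subring_mult[OF SQ])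
    ultimately show ?thesis using \<open>H \<in> Q\<close> unfolding unit_in_def by blast
  qed
  have "irreducible_in Q (\<iota> f)"
    unfolding irreducible_in_iff[OF SQ]
  proof (intro conjI ballI impI)
    show "\<iota> f \<in> Q" using f0 by (intro \<iota>_Q)
    show "\<iota> f \<noteq> 0" using f0 \<iota>_inj[of f 0] \<iota>.zero by auto
    show "\<not> unit_in Q (\<iota> f)"
    proof
      assume "unit_in Q (\<iota> f)"
      then obtain G where G: "G \<in> Q" "\<iota> f * G = 1" by (auto simp: unit_in_def)
      then obtain c G' where c: "c \<in> polys r" "c \<noteq> 0" "G' \<in> S"
        "mconst (to_fract c) * G = \<iota> G'"
        using clear_denominators unfolding Q_def S_def \<iota>_def by blast
      have "\<iota> (f * G') = mconst (to_fract c) * (\<iota> f * G)"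
        unfolding \<iota>.mult c(4)[symmetric] by (simp add: ac_simps)
      then have "\<iota> (f * G') = \<iota> (mconst c)" using G by (simp add: \<iota>_const)
      then show False using \<iota>_inj not_dvd c by blast
    qed
    fix G H assume GH: "G \<in> Q" "H \<in> Q" "\<iota> f = G * H"
    obtain c G' where c: "c \<in> polys r" "c \<noteq> 0" "G' \<in> S" "mconst (to_fract c) * G = \<iota> G'"
      using clear_denominators GH(1) unfolding Q_def S_def \<iota>_def by blast
    obtain d H' where d: "d \<in> polys r" "d \<noteq> 0" "H' \<in> S" "mconst (to_fract d) * H = \<iota> H'"
      using clear_denominators GH(2) unfolding Q_def S_def \<iota>_def by blast
    have "\<iota> (mconst (c * d) * f) = (mconst (to_fract c) * G) * (mconst (to_fract d) * H)"
      by (simp add: \<iota>.mult \<iota>_const GH(3) mconst_mult ac_simps)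
    then have "\<iota> (mconst (c * d) * f) = \<iota> (G' * H')" by (simp add: c d \<iota>.mult)
    then have eq: "mconst (c * d) * f = G' * H'" by (rule \<iota>_inj)
    have "mconst (c * d) \<in> S"
      unfolding S_def using c d by (intro mconst_in_mpolys subring_mult[OF subring_polys])
    then have "dvd_in S f (G' * H')" unfolding dvd_in_def eq[symmetric] by (metis mult.commute)
    then consider "dvd_in S f G'" | "dvd_in S f H'"
      using factorial_set_prime[OF factS f c(3) d(3)] by blast
    then show "unit_in Q G \<or> unit_in Q H"
    proof cases
      case 1
      then show ?thesis using main[OF c(1,2) d(1,2) GH(2) d(3) c(3) d(4) eq] by blast
    next
      case 2
      then show ?thesis
        using main[OF d(1,2) c(1,2) GH(1) c(3) d(3) c(4) _ 2] eq by (simp add: mult.commute)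
    qed
  qed
  then show ?thesis by (simp add: Q_def \<iota>_def f_def)
qed

subsection \<open>Specialization\<close>

text \<open>The two specializations may rest on different fractions for the same coefficient, but
  the cross-multiplied equation survives evaluation. This identifies the abstract polynomial in the
  definition of a Hilbert set with an explicit substitution.\<close>

lemma is_specialization_unique:
  assumes "is_specialization r t f q" "is_specialization r t f q'"
  shows "q = q'"
proof (rule poly_mapping_eqI)
  fix m
  interpret ring_morphism "eval_mpoly t" by (rule ring_morphism_eval_mpoly)
  obtain a b where ab: "eval_mpoly t b \<noteq> 0" "Poly_Mapping.lookup f m = Fract a b"
    "Poly_Mapping.lookup q m = eval_mpoly t a / eval_mpoly t b"
    using assms(1) unfolding is_specialization_def by blast
  obtain a' b' where ab': "eval_mpoly t b' \<noteq> 0" "Poly_Mapping.lookup f m = Fract a' b'"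
    "Poly_Mapping.lookup q' m = eval_mpoly t a' / eval_mpoly t b'"
    using assms(2) unfolding is_specialization_def by blast
  have "b \<noteq> 0" "b' \<noteq> 0" using ab(1) ab'(1) zero by auto
  then have "a * b' = a' * b" using ab(2) ab'(2) by (simp add: eq_fract)
  then have "eval_mpoly t a * eval_mpoly t b' = eval_mpoly t a' * eval_mpoly t b" by (metis mult)
  then show "Poly_Mapping.lookup q m = Poly_Mapping.lookup q' m"
    using ab ab' by (simp add: frac_eq_eq)
qed

lemma is_specialization_split_vars:
  fixes F :: "(nat, 'k::field) mpoly"
  assumes "F \<in> polys (r + n)"
  shows "is_specialization r t (cmap to_fract (split_vars r F))
    (msubst (\<lambda>v. if v < r then mconst (t v) else mvar (v - r)) F)"
proof -
  have eq: "msubst (\<lambda>v. if v < r then mconst (t v) else mvar (v - r)) F =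
    cmap (eval_mpoly t) (split_vars r F)"
    by (rule ring_morphism_eqI[OF ring_morphism_msubst ring_morphism_comp[OF
            ring_morphism_cmap[OF ring_morphism_eval_mpoly] ring_morphism_split_vars]
          subring_UNIV mpolys_UNIV])
      (auto simp: cmap_mconst[OF ring_morphism_eval_mpoly] cmap_mvar[OF ring_morphism_eval_mpoly])
  have "Poly_Mapping.lookup (split_vars r F) m \<in> polys r" for m
    using bij_betw_split_vars[of r n] assms subring_zero[OF subring_polys]
    by (intro lookup_in_mpolys[of _ "{..<n}"]) (auto simp: bij_betw_def)
  then show ?thesis
    unfolding is_specialization_def eq lookup_cmap[OF ring_morphism_to_fract]
      lookup_cmap[OF ring_morphism_eval_mpoly]
    using subring_one[OF subring_polys]
    by (intro allI bexI[of _ "Poly_Mapping.lookup (split_vars r F) m" for m] bexI[of _ 1])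
      (auto simp: to_fract_def ring_morphism.one[OF ring_morphism_eval_mpoly])
qed

lemma ring_morphism_mon_ev: "ring_morphism h \<Longrightarrow> h (mon_ev s m) = mon_ev (\<lambda>v. h (s v)) m"
  unfolding mon_ev_def by (simp add: ring_morphism.prod ring_morphism.power)

lemma mvar_neq_0 [simp]: "mvar v \<noteq> (0 :: ('v, 'a::zero_neq_one) mpoly)"
  by (metis lookup_single_eq lookup_zero mvar_def zero_neq_one)

subsection \<open>The generic value\<close>

text \<open>One numbering serves both situations: cutting the variables at \<open>k + 1\<close>
  leaves x_0, ..., x_{n-1} as unknowns, cutting at \<open>k + n\<close> leaves x_0 alone. The
  monomials 1 and x_0 are required in \<open>E\<close> since the coefficient of 1 carries the shear,
  that of x_0 gives non-divisibility, and both enter the separability argument. Shifts by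
  polynomials in x_0 alone, with x_0 unshifted, are triangular.\<close>

locale generic_value =
  fixes n k :: nat and E :: "(nat \<Rightarrow>\<^sub>0 nat) set" and idx :: "(nat \<Rightarrow>\<^sub>0 nat) \<Rightarrow> nat"
    and s :: "nat \<Rightarrow> (nat, 'k::field) mpoly"
  assumes n: "n \<ge> 1" and finite_E: "finite E"
    and idx: "bij_betw idx E {..k}" "idx 0 = k"
    and E: "0 \<in> E" "Poly_Mapping.single 0 1 \<in> E" "m \<in> E \<Longrightarrow> Poly_Mapping.keys m \<subseteq> {..<n}"
    and s0: "s 0 = 0" and s_in: "s i \<in> mpolys {k + n} UNIV"
begin

text \<open>
  The variables \<open>0, \<dots>, k\<close> are the coefficients \<open>\<lambda>\<^sub>m\<close> (\<open>m \<in> E\<close>) of the generic \<open>M\<close>, that of the constant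
  monomial being \<open>k\<close>; the variable \<open>k + n - i\<close> is \<open>x\<^sub>i\<close>, so that \<open>x\<^sub>0\<close> comes last.
  The shift \<open>s i\<close> of \<open>x\<^sub>i\<close> is \<open>0\<close> in the totally Hilbertian case and \<open>x\<^sub>0 ^ (B ^ i)\<close> in the Hilbertian one.
\<close>

definition xv :: "nat \<Rightarrow> (nat, 'k) mpoly" where
  "xv i = mvar (k + n - i) + s i"

definition \<Lambda> :: "(nat, 'k) mpoly" where
  "\<Lambda> = (\<Sum>m \<in> E. mvar (idx m) * mon_ev xv m)"

text \<open>On the side of \<open>P\<close>, the variables below \<open>n\<close> are the x_i and
  \<open>n\<close> is y. The values beyond \<open>n\<close> complete the substitution to an
  automorphism of the polynomial ring in all \<open>k + n + 1\<close> variables.\<close>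

definition \<Theta> :: "nat \<Rightarrow> (nat, 'k) mpoly" where
  "\<Theta> v = (if v < n then xv v else if v = n then \<Lambda> else mvar (k + n - v))"

definition F :: "(nat, 'k) mpoly poly \<Rightarrow> (nat, 'k) mpoly" where
  "F P = msubst \<Theta> (poly P (mvar n))"

abbreviation XS :: "(nat, 'k) mpoly set" where
  "XS \<equiv> mpolys {k<..k + n} UNIV"

lemma subring_XS: "subring_set XS"
  by (rule subring_mpolys[OF subring_UNIV])

lemma xv_0: "xv 0 = mvar (k + n)"
  by (simp add: xv_def s0)

lemma s_in_XS: "s i \<in> XS"
  using s_in[of i] n mpolys_mono[of "{k + n}" "{k<..k + n}" UNIV UNIV] by auto

lemma xv_in: "i < n \<Longrightarrow> xv i \<in> XS"
  unfolding xv_def by (intro subring_add[OF subring_XS] s_in_XS mvar_in_mpolys) auto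

lemma mon_ev_xv_in: "m \<in> E \<Longrightarrow> mon_ev xv m \<in> XS"
  unfolding mon_ev_def using E(3)[of m]
  by (intro subring_prod[OF subring_XS] subring_power[OF subring_XS] xv_in) auto

lemma idx_le: "m \<in> E \<Longrightarrow> idx m \<le> k"
  using idx by (auto simp: bij_betw_def)

lemma idx_inj: "m \<in> E \<Longrightarrow> m' \<in> E \<Longrightarrow> idx m = idx m' \<Longrightarrow> m = m'"
  using idx by (auto simp: bij_betw_def dest: inj_onD)

lemma idx_less: "m \<in> E \<Longrightarrow> m \<noteq> 0 \<Longrightarrow> idx m < k"
  using idx_le[of m] idx_inj[of m 0] E(1) idx(2) by fastforce

lemma msubst_\<Theta>_in: "c \<in> polys n \<Longrightarrow> msubst \<Theta> c \<in> XS"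
  by (rule msubst_in_mpolys) (auto simp: \<Theta>_def xv_in)

text \<open>A composition of three automorphisms: the reversal \<open>\<sigma>1\<close> of the
  numbering, the shift \<open>\<sigma>2\<close> of x_1, ..., x_{n-1} by polynomials in x_0, and the
  shear \<open>\<sigma>3\<close> of the constant coefficient by the other terms of M. The last may
  use the shifted x_i, since it fixes all polynomials in x.\<close>

lemma bij_\<Theta>: "bij_betw (msubst \<Theta>) (polys (Suc (k + n))) (polys (Suc (k + n)))"
proof -
  let ?V = "{..<Suc (k + n)}"
  define \<sigma>1 :: "nat \<Rightarrow> (nat, 'k) mpoly" where "\<sigma>1 = (\<lambda>v. mvar (k + n - v))"
  define W2 where "W2 = {k<..<k + n}"
  define s2 where "s2 v = s (k + n - v)" for v
  define \<sigma>2 where "\<sigma>2 = (\<lambda>v. if v \<in> W2 then mvar v + s2 v else mvar v)"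
  define s3 where "s3 = (\<lambda>v::nat. \<Sum>m \<in> E - {0}. mvar (idx m) * mon_ev xv m)"
  define \<sigma>3 where "\<sigma>3 = (\<lambda>v. if v \<in> {k} then mvar v + s3 v else mvar v)"
  have "bij_betw (msubst \<sigma>1) (polys (Suc (k + n))) (polys (Suc (k + n)))"
    unfolding \<sigma>1_def by (rule bij_betw_reversal) auto
  moreover have "bij_betw (msubst \<sigma>2) (polys (Suc (k + n))) (polys (Suc (k + n)))"
    unfolding \<sigma>2_def
  proof (rule bij_betw_shear)
    show "s2 v \<in> mpolys (?V - W2) UNIV" for v
      unfolding s2_def using s_in mpolys_mono[of "{k + n}" "?V - W2" UNIV UNIV]
      by (auto simp: W2_def)
  qed (auto simp: W2_def)
  moreover have "bij_betw (msubst \<sigma>3) (polys (Suc (k + n))) (polys (Suc (k + n)))"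
    unfolding \<sigma>3_def
  proof (rule bij_betw_shear)
    show "s3 v \<in> mpolys (?V - {k}) UNIV" for v
      unfolding s3_def
    proof (intro subring_sum subring_mult subring_mpolys subring_UNIV)
      fix m assume m: "m \<in> E - {0}"
      then show "mvar (idx m) \<in> mpolys (?V - {k}) UNIV"
        using idx_less[of m] by (intro mvar_in_mpolys) auto
      show "mon_ev xv m \<in> mpolys (?V - {k}) UNIV"
        by (rule mpolys_vars_mono[OF mon_ev_xv_in]) (use m in auto)
    qed
  qed auto
  ultimately have "bij_betw (msubst \<sigma>3 \<circ> (msubst \<sigma>2 \<circ> msubst \<sigma>1)) (polys (Suc (k + n))) (polys (Suc (k + n)))"
    by (intro bij_betw_trans)
  moreover have "msubst \<Theta> p = (msubst \<sigma>3 \<circ> (msubst \<sigma>2 \<circ> msubst \<sigma>1)) p" if "p \<in> polys (Suc (k + n))" for p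
  proof -
    have "\<Theta> v = msubst \<sigma>3 (msubst \<sigma>2 (\<sigma>1 v))" if v: "v < Suc (k + n)" for v
    proof -
      have \<sigma>3_fix: "msubst \<sigma>3 p = p" if "p \<in> XS" for p
        using that by (rule msubst_id) (auto simp: \<sigma>3_def)
      consider "v < n" "v = 0" | "v < n" "v > 0" | "v = n" | "v > n" by linarith
      then show ?thesis
      proof cases
        case 1
        then show ?thesis using n by (auto simp: \<Theta>_def xv_0 \<sigma>1_def \<sigma>2_def \<sigma>3_def W2_def)
      next
        case 2
        then have "msubst \<sigma>2 (\<sigma>1 v) = xv v"
          by (auto simp: \<sigma>1_def \<sigma>2_def W2_def s2_def xv_def)
        then show ?thesis using 2 xv_in \<sigma>3_fix by (simp add: \<Theta>_def)
      next
        case 3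
        have "\<Lambda> = mvar k + s3 k"
          unfolding \<Lambda>_def s3_def using E(1) finite_E idx(2) by (simp add: sum.remove)
        then show ?thesis using 3 n by (simp add: \<Theta>_def \<sigma>1_def \<sigma>2_def \<sigma>3_def W2_def)
      next
        case 4
        then show ?thesis using v by (auto simp: \<Theta>_def \<sigma>1_def \<sigma>2_def \<sigma>3_def W2_def)
      qed
    qed
    then show ?thesis unfolding comp_def msubst_msubst using that by (intro msubst_cong) auto
  qed
  ultimately show ?thesis by (subst bij_betw_cong)
qed

lemma poly_mvar_in: "P \<in> polys_y n \<Longrightarrow> poly P (mvar n) \<in> polys (Suc n)"
  unfolding polys_y_eq polys_Suc by (rule bij_betw_apply[OF bij_betw_poly_mvar]) simp_all

lemma poly_mvar_in': "P \<in> polys_y n \<Longrightarrow> poly P (mvar n) \<in> polys (Suc (k + n))"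
  using poly_mvar_in mpolys_mono[of "{..<Suc n}" "{..<Suc (k + n)}" UNIV UNIV] by auto

lemma F_in: "P \<in> polys_y n \<Longrightarrow> F P \<in> polys (Suc (k + n))"
  unfolding F_def using poly_mvar_in' bij_\<Theta> by (auto simp: bij_betw_def)

lemma irreducible_F:
  assumes "irreducible_in (polys_y n) P"
  shows "irreducible_in (polys (Suc (k + n))) (F P)"
proof -
  have P: "P \<in> polys_over (polys n)" using assms by (simp add: irreducible_in_def polys_y_eq)
  then have "irreducible_in (polys (Suc n)) (poly P (mvar n))"
    using assms unfolding polys_y_eq by (subst irreducible_in_polys_Suc)
  then have "irreducible_in (polys (Suc (k + n))) (poly P (mvar n))"
    by (rule irreducible_in_polys_mono) simp
  then show ?thesis
    unfolding F_def
    by (subst irreducible_in_iso[OF ring_morphism_msubst bij_\<Theta> _ subring_polys subring_polys])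
      (use P poly_mvar_in' in \<open>auto simp: polys_y_eq\<close>)
qed

lemma msubst_\<Theta>_neq_0: "p \<in> polys n \<Longrightarrow> p \<noteq> 0 \<Longrightarrow> msubst \<Theta> p \<noteq> 0"
proof
  assume p: "p \<in> polys n" "p \<noteq> 0" and eq: "msubst \<Theta> p = 0"
  have "p \<in> polys (Suc (k + n))" using p(1) by (rule mpolys_vars_mono) auto
  moreover have "msubst \<Theta> p = msubst \<Theta> 0"
    using eq by (simp add: ring_morphism.zero[OF ring_morphism_msubst])
  ultimately show False
    using bij_\<Theta> p(2) subring_zero[OF subring_polys] unfolding bij_betw_def by (metis inj_onD)
qed

text \<open>
  As a polynomial in the coefficient \<open>\<lambda>\<^sub>j\<close> of \<open>x\<^sub>0\<close>, \<open>F P\<close> has a leading coefficient divisible by \<open>x\<^sub>0\<close>.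
  A multiple of \<open>F P\<close> that is free of \<open>x\<^sub>0\<close> thus vanishes.
\<close>

lemma F_not_dvd:
  assumes P: "P \<in> polys_y n" "Polynomial.degree P \<ge> 1"
    and c: "c \<in> polys r" "c \<noteq> 0" "r \<le> k + n"
  shows "\<not> dvd_in (polys (Suc (k + n))) (F P) c"
proof
  assume "dvd_in (polys (Suc (k + n))) (F P) c"
  then obtain G where G: "c = F P * G" by (auto simp: dvd_in_def)
  define m1 :: "nat \<Rightarrow>\<^sub>0 nat" where "m1 = Poly_Mapping.single 0 1"
  define j where "j = idx m1"
  have m1: "m1 \<in> E" "m1 \<noteq> 0" using E(2) by (auto simp: m1_def dest: arg_cong[of _ _ "\<lambda>m. Poly_Mapping.lookup m 0"])
  then have j: "j < k" unfolding j_def by (rule idx_less)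
  let ?D = "as_upoly j :: (nat, 'k) mpoly \<Rightarrow> _"
  interpret D: ring_morphism ?D by (rule ring_morphism_as_upoly)
  have D_XS: "?D p = [:p:]" if "p \<in> XS" for p
    using that by (rule as_upoly_const) (use j in auto)
  define u where "u = (\<Sum>m \<in> E - {m1}. mvar (idx m) * mon_ev xv m)"
  have "?D (mvar (idx m) * mon_ev xv m) = [:mvar (idx m) * mon_ev xv m:]" if m: "m \<in> E - {m1}" for m
  proof -
    have "idx m \<noteq> j" using m idx_inj[of m m1] m1 by (auto simp: j_def)
    then show ?thesis using m by (simp add: D.mult D_XS mon_ev_xv_in)
  qed
  then have "?D u = (\<Sum>m \<in> E - {m1}. [:mvar (idx m) * mon_ev xv m:])"
    unfolding u_def D.sum by (rule sum.cong[OF refl])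
  also have "\<dots> = [:u:]"
    unfolding u_def by (rule ring_morphism.sum[OF ring_morphism_pconst, symmetric])
  finally have D_u: "?D u = [:u:]" .
  have "\<Lambda> = mvar j * xv 0 + u"
    unfolding \<Lambda>_def u_def using m1 finite_E by (simp add: sum.remove j_def m1_def)
  then have D_\<Lambda>: "?D \<Lambda> = [:u, xv 0:]"
    using D_u D_XS[of "xv 0"] xv_in[of 0] n by (simp add: D.add D.mult)
  define P' where "P' = map_poly (msubst \<Theta>) P"
  have coeffP: "poly.coeff P i \<in> polys n" for i using P by (simp add: polys_y_def)
  have zero: "msubst \<Theta> 0 = 0" by (rule ring_morphism.zero[OF ring_morphism_msubst])
  have "?D (F P) = poly (map_poly (\<lambda>p. ?D (msubst \<Theta> p)) P) (?D \<Lambda>)"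
    unfolding F_def
    by (subst ring_morphism.poly[OF ring_morphism_comp[OF ring_morphism_as_upoly ring_morphism_msubst]])
      (simp add: \<Theta>_def)
  also have "map_poly (\<lambda>p. ?D (msubst \<Theta> p)) P = map_poly (\<lambda>p. [:p:]) P'"
    unfolding P'_def
    by (intro poly_eqI) (simp add: coeff_map_poly zero D.zero D_XS msubst_\<Theta>_in coeffP)
  finally have DF: "?D (F P) = pcompose P' [:u, xv 0:]"
    by (simp add: D_\<Lambda> pcompose_altdef)
  have "msubst \<Theta> (lead_coeff P) \<noteq> 0"
    using P coeffP by (intro msubst_\<Theta>_neq_0) auto
  then have "Polynomial.degree P' = Polynomial.degree P"
    unfolding P'_def by (intro map_poly_degree_eq) auto
  then have lc: "lead_coeff (?D (F P)) = lead_coeff P' * mvar (k + n) ^ Polynomial.degree P"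
    unfolding DF by (subst lead_coeff_comp) (simp_all add: xv_0)
  \<comment> \<open>Setting x_0 = 0 kills the leading coefficient of \<open>F P\<close>, because the
    exponent \<open>degree P\<close> is positive, and with it that of the multiple \<open>c\<close>.
    But it fixes the latter, since x_0 has number \<open>k + n\<close> and \<open>c\<close> involves
    only numbers below \<open>r\<close>.\<close>
  define z :: "(nat, 'k) mpoly \<Rightarrow> (nat, 'k) mpoly"
    where "z = msubst (\<lambda>v. if v = k + n then 0 else mvar v)"
  interpret z: ring_morphism z unfolding z_def by (rule ring_morphism_msubst)
  have "z (mvar (k + n)) = 0" by (simp add: z_def)
  then have "z (lead_coeff (?D (F P))) = 0"
    unfolding lc using P(2) by (simp add: z.mult z.power)
  moreover have "lead_coeff (?D c) = lead_coeff (?D (F P)) * lead_coeff (?D G)"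
    unfolding G D.mult lead_coeff_mult ..
  ultimately have "z (lead_coeff (?D c)) = 0" by (simp add: z.mult)
  moreover have "lead_coeff (?D c) \<in> polys r"
    using as_upoly_in_polys_over[OF c(1), of j "{..<r}"] by (auto simp: polys_over_def)
  then have "z (lead_coeff (?D c)) = lead_coeff (?D c)"
    unfolding z_def by (rule msubst_id) (use c(3) in auto)
  ultimately have "?D c = 0" by simp
  then show False using c(2) by (simp add: as_upoly_eq_0_iff)
qed

section \<open>Specializing the generic value\<close>

definition value_at :: "(nat \<Rightarrow> 'k) \<Rightarrow> (nat, 'k) mpoly" where
  "value_at t = (\<Sum>m \<in> E. Poly_Mapping.single m (t (idx m)))"

text \<open>The unknown x_i ends up with number \<open>k + n - i - r\<close>: for
  \<open>r = k + n\<close> this makes x_0 the variable 0, for \<open>r = k + 1\<close> it lists the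
  x_i in reverse order.\<close>

definition spec :: "nat \<Rightarrow> (nat \<Rightarrow> 'k) \<Rightarrow> (nat, 'k) mpoly \<Rightarrow> (nat, 'k) mpoly" where
  "spec r t = msubst (\<lambda>v. if v < r then mconst (t v) else mvar (v - r))"

lemma ring_morphism_spec: "ring_morphism (spec r t)"
  unfolding spec_def by (rule ring_morphism_msubst)

text \<open>As \<open>k < r\<close>, all coefficients of the generic M become scalars, which turns
  it into \<open>value_at t\<close>. What the specialization does to the shifted x_i is collected in
  an outer substitution, so that one statement covers both choices of \<open>r\<close>.\<close>

lemma spec_F:
  assumes P: "P \<in> polys_y n" and r: "k < r"
  shows "spec r t (F P) = msubst (\<lambda>i. spec r t (xv i)) (poly P (value_at t))"
proof -
  let ?\<xi> = "msubst (\<lambda>i. spec r t (xv i))"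
  interpret sp: ring_morphism "spec r t" by (rule ring_morphism_spec)
  have "spec r t (msubst \<Theta> c) = ?\<xi> c" if "c \<in> polys n" for c
    unfolding spec_def msubst_msubst using that by (rule msubst_cong) (simp add: \<Theta>_def)
  then have "map_poly (\<lambda>c. spec r t (msubst \<Theta> c)) P = map_poly ?\<xi> P"
    using P by (intro poly_eqI)
      (simp add: coeff_map_poly ring_morphism.zero[OF ring_morphism_msubst] sp.zero polys_y_def)
  moreover have "spec r t \<Lambda> = ?\<xi> (value_at t)"
  proof -
    have "spec r t (mvar (idx m)) = mconst (t (idx m))" if "m \<in> E" for m
      using idx_le[OF that] r by (simp add: spec_def)
    then show ?thesis
      unfolding \<Lambda>_def value_at_def sp.sum ring_morphism.sum[OF ring_morphism_msubst]
      by (intro sum.cong refl) (simp add: sp.mult ev_single ring_morphism_mon_ev[OF ring_morphism_spec])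
  qed
  ultimately show ?thesis
    unfolding F_def
    by (subst ring_morphism.poly[OF ring_morphism_comp[OF ring_morphism_spec ring_morphism_msubst]],
        subst ring_morphism.poly[OF ring_morphism_msubst]) (simp add: \<Theta>_def)
qed

definition G :: "nat \<Rightarrow> (nat, 'k) mpoly poly \<Rightarrow> (nat, (nat, 'k) mpoly fract) mpoly" where
  "G r P = cmap to_fract (split_vars r (F P))"

lemma hilbert_data_G:
  assumes "finite Ps" "Ps \<noteq> {}"
    and "\<And>P. P \<in> Ps \<Longrightarrow> irreducible_in (polys_y n) P \<and> Polynomial.degree P \<ge> 1"
    and "g \<in> polys (Suc k)" "g \<noteq> 0" "k < r" "r \<le> k + n" "r + l = Suc (k + n)"
  shows "hilbert_data r l (G r ` Ps) g"
  unfolding hilbert_data_def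
proof (intro conjI ballI)
  show "g \<in> polys r"
    using assms(4,6) mpolys_mono[of "{..<Suc k}" "{..<r}" UNIV UNIV] by auto
  fix f assume "f \<in> G r ` Ps"
  then obtain P where P: "P \<in> Ps" "f = G r P" by auto
  show "irreducible_in (mpolys {..<l} (ratfuns r)) f"
    unfolding P(2) G_def
    by (rule irreducible_in_over_ratfuns)
      (use assms irreducible_F F_not_dvd P in \<open>auto simp: irreducible_in_def\<close>)
qed (use assms in auto)

lemma hilbert_set_G:
  assumes "t \<in> hilbert_set r l (G r ` Ps) g" "r + l = Suc (k + n)" "P \<in> Ps" "P \<in> polys_y n"
  shows "irreducible_in (polys l) (spec r t (F P))"
proof -
  obtain q where q: "is_specialization r t (G r P) q" "irreducible_in (polys l) q"
    using assms by (auto simp: hilbert_set_def)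
  have "is_specialization r t (G r P) (spec r t (F P))"
    unfolding G_def spec_def using F_in[OF assms(4)] assms(2)
    by (intro is_specialization_split_vars[of _ _ l]) simp
  then have "q = spec r t (F P)" using q(1) is_specialization_unique by blast
  then show ?thesis using q by simp
qed

text \<open>Without shifts the outer substitution merely reverses the order of the x_i, which is an
  automorphism.\<close>

lemma irreducible_of_spec:
  assumes "\<And>i. s i = 0" and q: "q \<in> polys n"
    and "irreducible_in (polys n) (msubst (\<lambda>i. spec (Suc k) t (xv i)) q)"
  shows "irreducible_in (polys n) q"
proof -
  have "msubst (\<lambda>i. spec (Suc k) t (xv i)) q = msubst (\<lambda>i. mvar (n - Suc i)) q"
    using q
  proof (rule msubst_cong)
    fix i assume "i \<in> {..<n}"
    then have "\<not> k + n - i < Suc k" by auto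
    then show "spec (Suc k) t (xv i) = mvar (n - Suc i)"
      by (simp add: xv_def assms spec_def)
  qed
  moreover have "bij_betw (msubst (\<lambda>i. mvar (n - Suc i))) (polys n) (polys n :: (nat, 'k) mpoly set)"
    by (rule bij_betw_reversal) auto
  ultimately show ?thesis
    using irreducible_in_iso[OF ring_morphism_msubst _ q subring_polys subring_polys] assms(3) by simp
qed

end

subsection \<open>Separability\<close>

text \<open>Sending the other variables to 1 matches \<open>upoly\<close>, which looks only at the
  exponent of variable 0. In this form it is a ring morphism and can be compared with
  \<open>as_upoly\<close>.\<close>

lemma upoly_eq_ev:
  "upoly f = ev (\<lambda>a. [:a:]) (\<lambda>v. if v = 0 then [:0, 1:] else 1) (f :: (nat, 'a::comm_ring_1) mpoly)"
proof -
  have "mon_ev (\<lambda>v. if v = 0 then [:0, 1:] else 1) m = [:0, 1 :: 'a:] ^ Poly_Mapping.lookup m 0"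
    for m :: "nat \<Rightarrow>\<^sub>0 nat"
  proof -
    have "mon_ev (\<lambda>v. if v = 0 then [:0, 1:] else 1) m =
      (\<Prod>v \<in> insert 0 (Poly_Mapping.keys m). if v = 0 then [:0, 1 :: 'a:] ^ Poly_Mapping.lookup m 0 else 1)"
      by (subst mon_ev_superset[of "insert 0 (Poly_Mapping.keys m)"], simp, blast) (rule prod.cong, auto)
    also have "\<dots> = [:0, 1 :: 'a:] ^ Poly_Mapping.lookup m 0"
      by (subst prod.delta) auto
    finally show ?thesis .
  qed
  then show ?thesis
    by (simp add: upoly_def ev_def monom_altdef)
qed

lemma upoly_cmap_split_vars:
  fixes f :: "(nat, 'k::field) mpoly"
  assumes "f \<in> polys (Suc r)"
  shows "upoly (cmap to_fract (split_vars r f)) = map_poly to_fract (as_upoly r f)"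
proof -
  let ?u = "ev (\<lambda>a::(nat, 'k) mpoly fract. [:a:]) (\<lambda>v::nat. if v = 0 then [:0, 1:] else 1)"
  note u = ring_morphism_ev[OF ring_morphism_pconst[where 'a = "(nat, 'k) mpoly fract"],
      of "\<lambda>v::nat. if v = 0 then [:0, 1:] else 1"]
  have u_simps [simp]: "?u (mconst a) = [:a:]" "?u (mvar 0) = [:0, 1:]" for a
    by (simp_all add: ev_mconst ev_mvar ring_morphism_pconst)
  note c = ring_morphism_cmap[OF ring_morphism_to_fract]
  have "?u (cmap to_fract (split_vars r f)) = map_poly to_fract (as_upoly r f)"
    by (rule ring_morphism_eqI[OF ring_morphism_comp[OF u ring_morphism_comp[OF c ring_morphism_split_vars]]
          ring_morphism_comp[OF ring_morphism.map_poly[OF ring_morphism_to_fract] ring_morphism_as_upoly]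
          subring_UNIV assms])
      (auto simp: cmap_mconst[OF ring_morphism_to_fract] cmap_mvar[OF ring_morphism_to_fract]
        map_poly_pCons less_Suc_eq)
  then show ?thesis by (simp add: upoly_eq_ev)
qed

lemma pderiv_root_of_order_ge_2:
  fixes p :: "'a::field poly"
  assumes "order z p \<ge> 2"
  shows "poly p z = 0" "poly (pderiv p) z = 0"
proof -
  have "[:- z, 1:] ^ 2 dvd p" using assms by (subst order_divides) simp
  then obtain q where "p = [:- z, 1:] ^ 2 * q" by (rule dvdE)
  then have q: "p = [:- z, 1:] * ([:- z, 1:] * q)" by (simp only: power2_eq_square mult.assoc)
  show "poly p z = 0" unfolding q by simp
  show "poly (pderiv p) z = 0" unfolding q pderiv_mult by simp
qed

lemma subring_of_nat: "subring_set A \<Longrightarrow> of_nat k \<in> A"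
  by (induction k) (auto intro: subring_zero subring_one subring_add)

text \<open>By degree, the irreducible \<open>u\<close> does not divide its nonzero derivative, so
  some combination of the two is a nonzero constant. A multiple root would be a common root of both
  and annihilate that constant.\<close>

lemma separable_polyI:
  fixes f :: "(nat, 'k::field) mpoly"
  assumes f: "irreducible_in (polys (Suc r)) f" and nz: "pderiv (as_upoly r f) \<noteq> 0"
  shows "separable_poly (cmap to_fract (split_vars r f))"
proof -
  define u where "u = as_upoly r f"
  have f_in: "f \<in> polys (Suc r)" using f by (simp add: irreducible_in_def)
  have u_in: "u \<in> polys_over (polys r)"
    unfolding u_def using f_in by (rule as_upoly_in_polys_over) (auto simp: lessThan_Suc)
  have u: "irreducible_in (polys_over (polys r)) u"
    using irreducible_in_polys_Suc[OF u_in] f by (simp add: u_def poly_as_upoly)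
  have deg: "Polynomial.degree u > 0"
    using nz unfolding u_def by (metis degree_eq_zeroE gr0I pderiv_0 pderiv_pCons pCons_0_0 add_0)
  have u'_in: "pderiv u \<in> polys_over (polys r)"
    using u_in unfolding polys_over_def mem_Collect_eq coeff_pderiv
    by (blast intro: subring_mult[OF subring_polys] subring_of_nat[OF subring_polys])
  have "\<not> dvd_in (polys_over (polys r)) u (pderiv u)"
  proof
    assume "dvd_in (polys_over (polys r)) u (pderiv u)"
    then have "u dvd pderiv u" by (auto simp: dvd_in_def)
    then have "Polynomial.degree u \<le> Polynomial.degree (pderiv u)"
      using nz by (intro dvd_imp_degree_le) (simp_all add: u_def)
    moreover have "Polynomial.degree (pderiv u) \<le> Polynomial.degree u - 1"
      by (rule degree_le) (auto simp: coeff_pderiv coeff_eq_0)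
    ultimately show False using deg by linarith
  qed
  from irreducible_in_polys_over_bezout[OF factorial_set_polys u deg u'_in this]
  obtain a b c where abc: "c \<noteq> 0" "a * u + b * pderiv u = [:c:]" by blast
  define h where "h x = to_ac (to_fract x)" for x :: "(nat, 'k) mpoly"
  have h: "ring_morphism h" unfolding h_def by unfold_locales auto
  interpret mh: ring_morphism "map_poly h" by (rule ring_morphism.map_poly[OF h])
  have "order z (map_poly to_ac (upoly (cmap to_fract (split_vars r f)))) < 2" for z
  proof (rule ccontr)
    have U: "map_poly to_ac (upoly (cmap to_fract (split_vars r f))) = map_poly h u"
      unfolding upoly_cmap_split_vars[OF f_in] u_def[symmetric]
      by (subst map_poly_map_poly) (auto simp: h_def[abs_def] comp_def)
    assume "\<not> ?thesis"
    then have "order z (map_poly h u) \<ge> 2" by (simp add: U)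
    from pderiv_root_of_order_ge_2[OF this]
    have roots: "poly (map_poly h u) z = 0" "poly (map_poly h (pderiv u)) z = 0"
      by (simp_all add: pderiv_map_poly[OF h])
    have "map_poly h [:c:] = map_poly h a * map_poly h u + map_poly h b * map_poly h (pderiv u)"
      unfolding abc(2)[symmetric] mh.add mh.mult ..
    then have "poly (map_poly h [:c:]) z = 0" using roots by simp
    then have "h c = 0" by (simp add: map_poly_pCons ring_morphism.zero[OF h])
    then show False using abc(1) by (simp add: h_def)
  qed
  then show ?thesis unfolding separable_poly_def by (metis not_le)
qed

lemma map_poly_as_upoly:
  fixes p :: "('v, 'a::comm_ring_1) mpoly"
  assumes "\<tau> v = mvar v" "\<And>u. u \<noteq> v \<Longrightarrow> \<tau> u \<in> mpolys (- {v}) UNIV"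
  shows "map_poly (msubst \<tau>) (as_upoly v p) = as_upoly v (msubst \<tau> p)"
proof (rule ring_morphism_eqI[OF
      ring_morphism_comp[OF ring_morphism.map_poly[OF ring_morphism_msubst] ring_morphism_as_upoly]
      ring_morphism_comp[OF ring_morphism_as_upoly ring_morphism_msubst] subring_UNIV mpolys_UNIV])
  note zero = ring_morphism.zero[OF ring_morphism_msubst, of \<tau>]
  show "map_poly (msubst \<tau>) (as_upoly v (mconst a)) = as_upoly v (msubst \<tau> (mconst a))" for a
    by (simp add: map_poly_pCons zero)
  show "map_poly (msubst \<tau>) (as_upoly v (mvar u)) = as_upoly v (msubst \<tau> (mvar u))" for u
  proof (cases "u = v")
    case True
    then show ?thesis
      by (simp add: map_poly_pCons zero assms(1) ring_morphism.one[OF ring_morphism_msubst])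
  next
    case False
    then have "as_upoly v (\<tau> u) = [:\<tau> u:]" by (intro as_upoly_const[OF assms(2)]) auto
    then show ?thesis using False by (simp add: map_poly_pCons zero)
  qed
qed

lemma degree_eq_1E:
  assumes "Polynomial.degree P = 1"
  shows "\<exists>a b. P = [:a, b:] \<and> b \<noteq> 0"
proof -
  obtain a q where q: "P = pCons a q" by (rule pCons_cases)
  then have "q \<noteq> 0" "Polynomial.degree q = 0"
    using assms by (auto simp: degree_pCons_eq_if split: if_splits)
  then show ?thesis using q by (metis degree_eq_zeroE pCons_0_0)
qed

context generic_value
begin

text \<open>
  If \<open>F P = A + \<Lambda> B\<close> had zero derivative with respect to \<open>x\<^sub>0\<close>, then so would \<open>A\<close>, \<open>A + B\<close> and \<open>A + x\<^sub>0 B\<close>.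
\<close>

lemma pderiv_F:
  assumes P: "P \<in> polys_y n" "Polynomial.degree P = 1"
  shows "pderiv (as_upoly (k + n) (F P)) \<noteq> 0"
proof
  let ?D = "as_upoly (k + n) :: (nat, 'k) mpoly \<Rightarrow> _"
  interpret D: ring_morphism ?D by (rule ring_morphism_as_upoly)
  assume 0: "pderiv (?D (F P)) = 0"
  obtain A B where AB: "P = [:A, B:]" "B \<noteq> 0"
    using degree_eq_1E[OF P(2)] by blast
  have AB_in: "A \<in> polys n" "B \<in> polys n"
    using P(1) by (auto simp: AB polys_y_eq pCons_in_polys_over)
  define a b where "a = msubst \<Theta> A" and "b = msubst \<Theta> B"
  have ab: "a \<in> XS" "b \<in> XS" using AB_in msubst_\<Theta>_in by (auto simp: a_def b_def)
  have F_eq: "F P = a + \<Lambda> * b"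
    unfolding F_def AB
    by (simp add: a_def b_def ring_morphism.add[OF ring_morphism_msubst]
        ring_morphism.mult[OF ring_morphism_msubst] \<Theta>_def)
  \<comment> \<open>Specializing the coefficients to scalars \<open>c\<close> commutes with the
    derivative in x_0. It is applied with \<open>c\<close> zero, with the indicator of the monomial
    1 and with that of x_0.\<close>
  have *: "pderiv (?D (a + w * b)) = 0" if w: "w = (\<Sum>m \<in> E. mconst (c (idx m)) * mon_ev xv m)" for w c
  proof -
    define \<tau> :: "nat \<Rightarrow> (nat, 'k) mpoly" where "\<tau> v = (if v \<le> k then mconst (c v) else mvar v)" for v
    interpret \<tau>: ring_morphism "msubst \<tau>" by (rule ring_morphism_msubst)
    have \<tau>_XS: "msubst \<tau> p = p" if "p \<in> XS" for p
      using that by (rule msubst_id) (auto simp: \<tau>_def)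
    have "msubst \<tau> \<Lambda> = w"
      unfolding \<Lambda>_def \<tau>.sum w
      by (intro sum.cong refl) (simp add: \<tau>.mult \<tau>_XS mon_ev_xv_in, simp add: \<tau>_def idx_le)
    then have "msubst \<tau> (F P) = a + w * b"
      by (simp add: F_eq \<tau>.add \<tau>.mult \<tau>_XS ab)
    moreover have "map_poly (msubst \<tau>) (?D (F P)) = ?D (msubst \<tau> (F P))"
      using n by (intro map_poly_as_upoly) (auto simp: \<tau>_def intro: mconst_in_mpolys mvar_in_mpolys)
    ultimately have "pderiv (?D (a + w * b)) = pderiv (map_poly (msubst \<tau>) (?D (F P)))" by simp
    also have "\<dots> = 0"
      unfolding pderiv_map_poly[OF ring_morphism_msubst] 0 by simp
    finally show ?thesis .
  qed
  have delta: "(\<Sum>m \<in> E. mconst (if idx m = idx m' then 1 else 0) * mon_ev xv m) = mon_ev xv m'"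
    if m': "m' \<in> E" for m'
  proof -
    have "(\<Sum>m \<in> E. mconst (if idx m = idx m' then 1 else 0) * mon_ev xv m) =
      (\<Sum>m \<in> E. if m = m' then mon_ev xv m else 0)"
      using m' idx_inj by (intro sum.cong) auto
    also have "\<dots> = mon_ev xv m'" using m' finite_E by simp
    finally show ?thesis .
  qed
  have "pderiv (?D (a + 0 * b)) = 0"
    by (rule *[where c = "\<lambda>_. 0"]) simp
  moreover have "pderiv (?D (a + mon_ev xv m * b)) = 0" if "m \<in> E" for m
    by (rule *[where c = "\<lambda>j. if j = idx m then 1 else 0"]) (simp add: delta that)
  from this[OF E(1)] this[OF E(2)] have "pderiv (?D (a + b)) = 0" "pderiv (?D (a + mvar (k + n) * b)) = 0"
    by (simp_all add: xv_0)
  ultimately have "pderiv (?D a) = 0" "pderiv (?D b) = 0" "pderiv ([:0, 1:] * ?D b) = 0"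
    by (simp_all add: D.add D.mult pderiv_add del: mult_pCons_left)
  \<comment> \<open>By the product rule the derivative of x_0 b is b + x_0 b', which reduces to b,
    in every characteristic.\<close>
  then have "?D b = 0" by (simp add: pderiv_pCons)
  then have "b = 0" by (simp add: as_upoly_eq_0_iff)
  then show False using msubst_\<Theta>_neq_0[OF AB_in(2) AB(2)] by (simp add: b_def)
qed

end

subsection \<open>Irreducibility from a line\<close>

text \<open>
  Nagata's substitution \<open>x\<^sub>i \<mapsto> x\<^sub>i + x\<^sub>0 ^ (B ^ i)\<close> (\<open>i \<ge> 1\<close>) gives a polynomial with all exponents
  below \<open>B\<close> a constant leading coefficient in \<open>x\<^sub>0\<close>: distinct monomials get distinct degrees.
\<close>

definition nagata :: "nat \<Rightarrow> (nat, 'a::comm_ring_1) mpoly \<Rightarrow> (nat, 'a) mpoly poly" where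
  "nagata B = ev (\<lambda>a. [:mconst a:])
     (\<lambda>i. if i = 0 then [:0, 1:] else [:mvar i:] + [:0, 1:] ^ (B ^ i))"

lemma ring_morphism_nagata: "ring_morphism (nagata B)"
  unfolding nagata_def
  by (intro ring_morphism_ev ring_morphism_comp[OF ring_morphism_pconst ring_morphism_mconst])

lemma nagata_mconst: "nagata B (mconst a) = [:mconst a:]"
  and nagata_mvar: "nagata B (mvar i) = (if i = 0 then [:0, 1:] else [:mvar i:] + [:0, 1:] ^ (B ^ i))"
  unfolding nagata_def
  by (simp_all add: ev_mconst ev_mvar ring_morphism_comp[OF ring_morphism_pconst ring_morphism_mconst])

lemma base_expansion_inj:
  fixes a b :: "nat \<Rightarrow> nat"
  assumes "(\<Sum>i<n. a i * B ^ i) = (\<Sum>i<n. b i * B ^ i)" "\<And>i. i < n \<Longrightarrow> a i < B" "\<And>i. i < n \<Longrightarrow> b i < B"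
    and "i < n"
  shows "a i = b i"
  using assms
proof (induction n arbitrary: a b i)
  case (Suc n)
  have shift: "(\<Sum>i<Suc n. c i * B ^ i) = c 0 + B * (\<Sum>i<n. c (Suc i) * B ^ i)" for c :: "nat \<Rightarrow> nat"
    unfolding sum.lessThan_Suc_shift by (simp add: sum_distrib_left mult.left_commute)
  have eq: "a 0 + B * (\<Sum>i<n. a (Suc i) * B ^ i) = b 0 + B * (\<Sum>i<n. b (Suc i) * B ^ i)"
    using Suc.prems(1) unfolding shift .
  have lt: "a 0 < B" "b 0 < B" using Suc.prems by auto
  have "a 0 = (a 0 + B * (\<Sum>i<n. a (Suc i) * B ^ i)) mod B" using lt by simp
  also have "\<dots> = b 0" unfolding eq using lt by simp
  finally have 0: "a 0 = b 0" .
  then have "(\<Sum>i<n. a (Suc i) * B ^ i) = (\<Sum>i<n. b (Suc i) * B ^ i)" using eq lt by simp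
  then have "a (Suc i) = b (Suc i)" if "i < n" for i
    using Suc.IH[of "\<lambda>i. a (Suc i)" "\<lambda>i. b (Suc i)" i] Suc.prems that by auto
  then show ?case using 0 Suc.prems(4) by (cases i) auto
qed simp

lemma lead_coeff_nagata:
  fixes f :: "(nat, 'k::field) mpoly"
  assumes f: "f \<in> polys n" "f \<noteq> 0"
    and B: "\<And>m i. m \<in> Poly_Mapping.keys f \<Longrightarrow> Poly_Mapping.lookup m i < B"
  shows "\<exists>a. a \<noteq> 0 \<and> lead_coeff (nagata B f) = mconst a"
proof -
  define y :: "nat \<Rightarrow> (nat, 'k) mpoly poly"
    where "y i = (if i = 0 then [:0, 1:] else [:mvar i:] + [:0, 1:] ^ (B ^ i))" for i
  \<comment> \<open>The exponents of \<open>m\<close> are the base-\<open>B\<close> digits of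
    \<open>w m\<close>, so \<open>w\<close> separates the monomials of \<open>f\<close>, and exactly
    one of them attains the maximum.\<close>
  define w where "w m = (\<Sum>i<n. Poly_Mapping.lookup m i * B ^ i)" for m :: "nat \<Rightarrow>\<^sub>0 nat"
  have keys_n: "Poly_Mapping.keys m \<subseteq> {..<n}" if "m \<in> Poly_Mapping.keys f" for m
    using f(1) that by (rule keys_subset_mpolys)
  obtain m\<^sub>1 where "m\<^sub>1 \<in> Poly_Mapping.keys f"
    using f(2) by (metis all_not_in_conv in_keys_iff lookup_zero poly_mapping_eqI)
  then have "B > 0" using B[of m\<^sub>1 0] by simp
  have y: "Polynomial.degree (y i) = B ^ i" "lead_coeff (y i) = 1" "y i \<noteq> 0" for i
  proof -
    have *: "Polynomial.degree ([:0, 1:] ^ (B ^ i) :: (nat, 'k) mpoly poly) = B ^ i"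
      by (simp add: degree_power_eq)
    show deg: "Polynomial.degree (y i) = B ^ i"
      unfolding y_def using \<open>B > 0\<close> by (auto simp: * degree_add_eq_right)
    show "lead_coeff (y i) = 1"
    proof (cases "i = 0")
      case False
      have "lead_coeff ([:mvar i:] + [:0, 1:] ^ (B ^ i) :: (nat, 'k) mpoly poly) =
        lead_coeff ([:0, 1:] ^ (B ^ i))"
        using \<open>B > 0\<close> by (intro lead_coeff_add_le) (simp add: *)
      then show ?thesis using False by (simp add: y_def lead_coeff_power)
    qed (simp add: y_def)
    then show "y i \<noteq> 0" by auto
  qed
  have mon: "Polynomial.degree (mon_ev y m) = w m" "lead_coeff (mon_ev y m) = 1"
    if "m \<in> Poly_Mapping.keys f" for m
  proof -
    have eq: "mon_ev y m = (\<Prod>i<n. y i ^ Poly_Mapping.lookup m i)"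
      by (rule mon_ev_superset) (use keys_n[OF that] in auto)
    show "Polynomial.degree (mon_ev y m) = w m"
      unfolding eq w_def by (subst degree_prod_eq_sum_degree) (auto simp: y degree_power_eq)
    show "lead_coeff (mon_ev y m) = 1"
      unfolding eq by (simp add: lead_coeff_prod lead_coeff_power y(2))
  qed
  have fin: "finite (w ` Poly_Mapping.keys f)" "w ` Poly_Mapping.keys f \<noteq> {}"
    using \<open>m\<^sub>1 \<in> Poly_Mapping.keys f\<close> by auto
  obtain m\<^sub>0 where m\<^sub>0: "m\<^sub>0 \<in> Poly_Mapping.keys f" "\<And>m. m \<in> Poly_Mapping.keys f \<Longrightarrow> w m \<le> w m\<^sub>0"
    using Max_in[OF fin] Max_ge[OF fin(1)] by (metis (no_types, lifting) image_iff)
  have w_less: "w m < w m\<^sub>0" if m: "m \<in> Poly_Mapping.keys f" "m \<noteq> m\<^sub>0" for m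
  proof -
    have "w m \<noteq> w m\<^sub>0"
    proof
      assume "w m = w m\<^sub>0"
      then have "Poly_Mapping.lookup m i = Poly_Mapping.lookup m\<^sub>0 i" if "i < n" for i
        unfolding w_def by (rule base_expansion_inj) (use B m m\<^sub>0 that in auto)
      moreover have "Poly_Mapping.lookup m i = Poly_Mapping.lookup m\<^sub>0 i" if "\<not> i < n" for i
        using keys_n[OF m(1)] keys_n[OF m\<^sub>0(1)] that by (metis in_keys_iff lessThan_iff subsetD)
      ultimately show False using m(2) poly_mapping_eqI by metis
    qed
    then show ?thesis using m\<^sub>0(2)[OF m(1)] by simp
  qed
  have nag: "nagata B f = (\<Sum>m \<in> Poly_Mapping.keys f. [:mconst (Poly_Mapping.lookup f m):] * mon_ev y m)"
    unfolding nagata_def ev_def y_def ..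
  have "Polynomial.degree (nagata B f) \<le> w m\<^sub>0"
    unfolding nag
  proof (rule degree_sum_le)
    fix m assume "m \<in> Poly_Mapping.keys f"
    then show "Polynomial.degree ([:mconst (Poly_Mapping.lookup f m):] * mon_ev y m) \<le> w m\<^sub>0"
      using m\<^sub>0 mon(1)[of m] by (auto intro: order_trans[OF degree_smult_le])
  qed simp
  moreover have coeff: "poly.coeff (nagata B f) (w m\<^sub>0) = mconst (Poly_Mapping.lookup f m\<^sub>0)"
  proof -
    have "poly.coeff (nagata B f) (w m\<^sub>0) =
      (\<Sum>m \<in> Poly_Mapping.keys f. if m = m\<^sub>0 then mconst (Poly_Mapping.lookup f m\<^sub>0) else 0)"
      unfolding nag coeff_sum
    proof (rule sum.cong[OF refl])
      fix m assume m: "m \<in> Poly_Mapping.keys f"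
      show "poly.coeff ([:mconst (Poly_Mapping.lookup f m):] * mon_ev y m) (w m\<^sub>0) =
        (if m = m\<^sub>0 then mconst (Poly_Mapping.lookup f m\<^sub>0) else 0)"
        using mon[OF m] w_less[OF m] by (cases "m = m\<^sub>0") (auto simp: coeff_eq_0)
    qed
    also have "\<dots> = mconst (Poly_Mapping.lookup f m\<^sub>0)" using m\<^sub>0(1) by simp
    finally show ?thesis .
  qed
  moreover have "Poly_Mapping.lookup f m\<^sub>0 \<noteq> 0" using m\<^sub>0(1) by (simp add: in_keys_iff)
  ultimately have "Polynomial.degree (nagata B f) = w m\<^sub>0"
    by (metis le_antisym le_degree mconst_eq_0_iff)
  then show ?thesis using coeff \<open>Poly_Mapping.lookup f m\<^sub>0 \<noteq> 0\<close> by auto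
qed

text \<open>The Nagata image of each factor has a constant leading coefficient, so fixing x_1, ...,
  x_{n-1} keeps its degree. If the factor becomes a unit on the line, that degree is 0, and the
  image equals its own leading coefficient; as the Nagata substitution is invertible, the factor was
  a constant.\<close>

lemma irreducible_in_polys_of_line:
  fixes f :: "(nat, 'k::field) mpoly"
  assumes n: "n \<ge> 1" and f: "f \<in> polys n"
    and B: "\<And>m i. m \<in> Poly_Mapping.keys f \<Longrightarrow> Poly_Mapping.lookup m i < B"
    and irr: "irreducible_in (polys 1)
      (msubst (\<lambda>i. if i = 0 then mvar 0 else mconst (\<tau> i) + mvar 0 ^ (B ^ i)) f)"
  shows "irreducible_in (polys n) f"
proof -
  define \<xi> :: "nat \<Rightarrow> (nat, 'k) mpoly"
    where "\<xi> i = (if i = 0 then mvar 0 else mconst (\<tau> i) + mvar 0 ^ (B ^ i))" for i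
  interpret \<xi>: ring_morphism "msubst \<xi>" by (rule ring_morphism_msubst)
  interpret nag: ring_morphism "nagata B :: (nat, 'k) mpoly \<Rightarrow> _" by (rule ring_morphism_nagata)
  define \<zeta> where "\<zeta> = (msubst (\<lambda>i. mconst (\<tau> i)) :: (nat, 'k) mpoly \<Rightarrow> (nat, 'k) mpoly)"
  have \<zeta>: "ring_morphism \<zeta>" unfolding \<zeta>_def by (rule ring_morphism_msubst)
  interpret m\<zeta>: ring_morphism "map_poly \<zeta>" by (rule ring_morphism.map_poly[OF \<zeta>])
  have \<zeta>_simps: "\<zeta> (mconst a) = mconst a" "\<zeta> (mvar i) = mconst (\<tau> i)" "\<zeta> 0 = 0" "\<zeta> 1 = 1" for a i
    by (simp_all add: \<zeta>_def ring_morphism.zero[OF ring_morphism_msubst] ring_morphism.one[OF ring_morphism_msubst])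
  have \<xi>_eq: "msubst \<xi> p = poly (map_poly \<zeta> (nagata B p)) (mvar 0)" for p
    by (rule ring_morphism_eqI[OF ring_morphism_msubst ring_morphism_comp[OF ring_morphism_poly
            ring_morphism_comp[OF m\<zeta>.ring_morphism_axioms ring_morphism_nagata]] subring_UNIV mpolys_UNIV])
      (auto simp: nagata_mconst nagata_mvar map_poly_pCons \<zeta>_simps \<xi>_def m\<zeta>.add m\<zeta>.power)
  have irr: "irreducible_in (polys 1) (msubst \<xi> f)"
    using irr by (simp add: \<xi>_def[abs_def])
  have nag_in: "nagata B p \<in> polys_over (polys n)" if "p \<in> polys n" for p :: "(nat, 'k) mpoly"
  proof (rule ring_morphism_in_subring[OF ring_morphism_nagata subring_UNIV
        subring_polys_over[OF subring_polys] that])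
    have "[:0, 1:] \<in> polys_over (polys n :: (nat, 'k) mpoly set)"
      using subring_zero[OF subring_polys_over[OF subring_polys]]
      by (auto simp: pCons_in_polys_over subring_zero[OF subring_polys] subring_one[OF subring_polys])
    then show "nagata B (mvar v) \<in> polys_over (polys n :: (nat, 'k) mpoly set)" if "v \<in> {..<n}" for v
      using that subring_polys_over[OF subring_polys]
      by (auto simp: nagata_mvar const_in_polys_over[OF subring_polys] mvar_in_mpolys
          intro!: subring_add subring_power)
  qed (simp add: nagata_mconst const_in_polys_over[OF subring_polys] mconst_in_mpolys)
  have nag_const: "p = mconst a" if p: "nagata B p = [:mconst a:]" for p :: "(nat, 'k) mpoly" and a
  proof -
    \<comment> \<open>Undoes the shift: followed by setting the main variable to
      \<open>mvar 0\<close>, it recovers \<open>p\<close> from \<open>nagata B p\<close>.\<close>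
    define \<upsilon> where "\<upsilon> = (msubst (\<lambda>i. mvar i - mvar 0 ^ (B ^ i)) :: (nat, 'k) mpoly \<Rightarrow> (nat, 'k) mpoly)"
    have \<upsilon>: "ring_morphism \<upsilon>" unfolding \<upsilon>_def by (rule ring_morphism_msubst)
    interpret m\<upsilon>: ring_morphism "map_poly \<upsilon>" by (rule ring_morphism.map_poly[OF \<upsilon>])
    have \<upsilon>_simps: "\<upsilon> (mconst a) = mconst a" "\<upsilon> (mvar i) = mvar i - mvar 0 ^ (B ^ i)" "\<upsilon> 0 = 0" "\<upsilon> 1 = 1" for a i
      by (simp_all add: \<upsilon>_def ring_morphism.zero[OF ring_morphism_msubst] ring_morphism.one[OF ring_morphism_msubst])
    have "poly (map_poly \<upsilon> (nagata B p)) (mvar 0) = p"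
      by (rule ring_morphism_eqI[OF ring_morphism_comp[OF ring_morphism_poly ring_morphism_comp[OF
                m\<upsilon>.ring_morphism_axioms ring_morphism_nagata]] ring_morphism_id subring_UNIV mpolys_UNIV])
        (auto simp: nagata_mconst nagata_mvar map_poly_pCons \<upsilon>_simps m\<upsilon>.add m\<upsilon>.power)
    then show ?thesis by (simp add: p map_poly_pCons \<upsilon>_simps)
  qed
  have f0: "f \<noteq> 0"
    using irr \<xi>.zero by (auto simp: irreducible_in_iff[OF subring_polys])
  then obtain a where a: "a \<noteq> 0" "lead_coeff (nagata B f) = mconst a"
    using lead_coeff_nagata[OF f _ B] by blast
  have unit: "unit_in (polys n) g"
    if g: "g \<in> polys n" "h \<in> polys n" "f = g * h" "unit_in (polys 1) (msubst \<xi> g)" for g h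
  proof -
    have "lead_coeff (nagata B g) * lead_coeff (nagata B h) = mconst a"
      using a(2) unfolding g(3) nag.mult lead_coeff_mult .
    moreover have "lead_coeff (nagata B g) \<in> polys n" "lead_coeff (nagata B h) \<in> polys n"
      using nag_in g(1,2) by (auto simp: polys_over_def)
    moreover have "unit_in (polys n) (mconst a)" using a(1) by (auto simp: unit_in_polys_iff)
    ultimately have "unit_in (polys n) (lead_coeff (nagata B g))"
      using unit_in_multD(1)[OF subring_polys] by metis
    then obtain b where b: "b \<noteq> 0" "lead_coeff (nagata B g) = mconst b"
      by (auto simp: unit_in_polys_iff)
    obtain e where e: "msubst \<xi> g = mconst e" using g(4) by (auto simp: unit_in_polys_iff)
    have deg: "Polynomial.degree (map_poly \<zeta> (nagata B g)) = Polynomial.degree (nagata B g)"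
      by (rule map_poly_degree_eq) (simp add: b \<zeta>_simps)
    have "\<zeta> p \<in> polys 0" for p
      unfolding \<zeta>_def by (rule msubst_in_mpolys[OF mpolys_UNIV]) (simp add: mconst_in_mpolys)
    then have "map_poly \<zeta> (nagata B g) \<in> polys_over (polys 0)"
      unfolding polys_over_def by (simp add: coeff_map_poly \<zeta>_simps(3))
    moreover have "[:mconst e:] \<in> polys_over (polys 0 :: (nat, 'k) mpoly set)"
      unfolding const_in_polys_over[OF subring_polys] by (simp add: mconst_in_mpolys)
    moreover have "poly (map_poly \<zeta> (nagata B g)) (mvar 0) = poly [:mconst e:] (mvar 0)"
      using e unfolding \<xi>_eq by simp
    moreover have "inj_on (\<lambda>P. poly P (mvar 0)) (polys_over (polys 0 :: (nat, 'k) mpoly set))"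
      by (rule bij_betw_imp_inj_on[OF bij_betw_poly_mvar]) simp
    ultimately have "map_poly \<zeta> (nagata B g) = [:mconst e:]"
      by (blast dest: inj_onD)
    then have "Polynomial.degree (nagata B g) = 0" using deg by simp
    then have "nagata B g = [:mconst b:]" using b(2) by (metis coeff_pCons_0 degree_eq_zeroE)
    then show ?thesis using nag_const b(1) by (auto simp: unit_in_polys_iff)
  qed
  show ?thesis
    unfolding irreducible_in_iff[OF subring_polys]
  proof (intro conjI ballI impI)
    show "\<not> unit_in (polys n) f"
      using irr by (auto simp: irreducible_in_iff[OF subring_polys] unit_in_polys_iff)
    fix g h assume gh: "g \<in> polys n" "h \<in> polys n" "f = g * h"
    have in1: "msubst \<xi> p \<in> polys 1" for p
      by (rule msubst_in_mpolys[OF mpolys_UNIV])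
        (auto simp: \<xi>_def intro!: subring_add[OF subring_polys] subring_power[OF subring_polys]
          mconst_in_mpolys mvar_in_mpolys)
    have "unit_in (polys 1) (msubst \<xi> g) \<or> unit_in (polys 1) (msubst \<xi> h)"
      using irr in1 unfolding irreducible_in_iff[OF subring_polys] gh(3) \<xi>.mult by blast
    then show "unit_in (polys n) g \<or> unit_in (polys n) h"
      using unit[OF gh] unit[OF gh(2,1)] gh(3) by (auto simp: mult.commute)
  qed (use f f0 in auto)
qed

subsection \<open>Density\<close>

lemma finite_exponents: "finite (exponents n d)"
proof (rule inj_on_finite)
  show "(\<lambda>m. restrict (Poly_Mapping.lookup m) {..<n}) ` exponents n d \<subseteq> (\<Pi>\<^sub>E i\<in>{..<n}. {..d i})"
    by (rule image_subsetI) (simp add: restrict_PiE_iff exponents_def)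
  show "finite (\<Pi>\<^sub>E i\<in>{..<n}. {..d i})" by (intro finite_PiE) auto
  show "inj_on (\<lambda>m. restrict (Poly_Mapping.lookup m) {..<n}) (exponents n d)"
  proof (intro inj_onI poly_mapping_eqI)
    fix m m' :: "nat \<Rightarrow>\<^sub>0 nat" and i
    assume m: "m \<in> exponents n d" "m' \<in> exponents n d"
      and eq: "restrict (Poly_Mapping.lookup m) {..<n} = restrict (Poly_Mapping.lookup m') {..<n}"
    show "Poly_Mapping.lookup m i = Poly_Mapping.lookup m' i"
    proof (cases "i < n")
      case True
      then show ?thesis using fun_cong[OF eq, of i] by simp
    next
      case False
      then have "i \<notin> Poly_Mapping.keys m" "i \<notin> Poly_Mapping.keys m'"
        using m by (auto simp: exponents_def)
      then show ?thesis by (simp add: in_keys_iff)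
    qed
  qed
qed

lemma ex_exponent_bound:
  assumes "finite S"
  shows "\<exists>b. \<forall>m \<in> S. \<forall>v. Poly_Mapping.lookup m v \<le> (b :: nat)"
  using assms
proof (induction S)
  case (insert m S)
  then obtain b where b: "\<forall>m \<in> S. \<forall>v. Poly_Mapping.lookup m v \<le> b" by blast
  let ?c = "\<Sum>v \<in> Poly_Mapping.keys m. Poly_Mapping.lookup m v"
  have "Poly_Mapping.lookup m v \<le> ?c" for v
    by (cases "v \<in> Poly_Mapping.keys m") (auto simp: in_keys_iff intro: member_le_sum)
  then show ?case using b by (intro exI[of _ "b + ?c"]) (auto intro: trans_le_add1 trans_le_add2)
qed simp

context generic_value
begin

lemma lookup_value_at:
  "Poly_Mapping.lookup (value_at t) m = (if m \<in> E then t (idx m) else 0)"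
  using finite_E by (simp add: value_at_def lookup_sum lookup_single when_def)

lemma keys_value_at: "Poly_Mapping.keys (value_at t) \<subseteq> E"
  by (auto simp: in_keys_iff lookup_value_at split: if_splits)

lemma value_at_in_polys: "value_at t \<in> polys n"
  using keys_value_at[of t] E(3) by (auto simp: mpolys_def)

lemma poly_value_at_in_polys:
  assumes "P \<in> polys_y n"
  shows "poly P (value_at t) \<in> polys n"
  using assms unfolding polys_y_eq
proof (induction P)
  case (pCons a P)
  then show ?case
    by (auto simp: pCons_in_polys_over value_at_in_polys
        intro!: subring_add[OF subring_polys] subring_mult[OF subring_polys])
qed (simp add: subring_zero[OF subring_polys])

text \<open>A hypersurface \<open>H\<close> in the space of coefficient tuples is turned into a condition \<open>g \<noteq> 0\<close> on the \<open>\<lambda>\<^sub>m\<close>.\<close>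

lemma ex_value_at:
  assumes H: "H \<in> mpolys E UNIV" "H \<noteq> 0"
    and Q: "\<And>g. g \<in> polys (Suc k) \<Longrightarrow> g \<noteq> 0 \<Longrightarrow> \<exists>t. eval_mpoly t g \<noteq> 0 \<and> Q t"
  shows "\<exists>t. Q t \<and> eval_mpoly (Poly_Mapping.lookup (value_at t)) H \<noteq> 0"
proof -
  define g where "g = msubst (\<lambda>m. mvar (idx m)) H"
  have "msubst (\<lambda>j. mvar (inv_into E idx j)) g = H"
    unfolding g_def msubst_msubst using H(1) idx(1)
    by (intro msubst_id[of _ E]) (auto simp: bij_betw_def)
  then have "g \<noteq> 0" using H(2) ring_morphism.zero[OF ring_morphism_msubst] by metis
  moreover have "g \<in> polys (Suc k)"
    unfolding g_def using H(1)
  proof (rule msubst_in_mpolys)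
    show "mvar (idx m) \<in> polys (Suc k)" if "m \<in> E" for m
      using idx_le[OF that] by (intro mvar_in_mpolys) auto
  qed
  ultimately obtain t where t: "eval_mpoly t g \<noteq> 0" "Q t" using Q by blast
  have "eval_mpoly t (msubst (\<lambda>m. mvar (idx m)) H) = eval_mpoly (Poly_Mapping.lookup (value_at t)) H"
    by (rule ring_morphism_eqI[OF ring_morphism_comp[OF ring_morphism_eval_mpoly ring_morphism_msubst]
          ring_morphism_eval_mpoly subring_UNIV H(1)]) (auto simp: lookup_value_at)
  then show ?thesis using t g_def by auto
qed

lemma ex_value_at_irreducible_totally_hilbertian:
  assumes s: "\<And>i. s i = 0" and K: "totally_hilbertian TYPE('k)"
    and Ps: "finite Ps" "Ps \<noteq> {}"
      "\<And>P. P \<in> Ps \<Longrightarrow> irreducible_in (polys_y n) P \<and> Polynomial.degree P \<ge> 1"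
    and g: "g \<in> polys (Suc k)" "g \<noteq> 0"
  shows "\<exists>t. eval_mpoly t g \<noteq> 0 \<and> (\<forall>P \<in> Ps. irreducible_in (polys n) (poly P (value_at t)))"
proof -
  have "hilbert_data (Suc k) n (G (Suc k) ` Ps) g"
    using Ps g n by (intro hilbert_data_G) auto
  then have "hilbert_subset (Suc k) (hilbert_set (Suc k) n (G (Suc k) ` Ps) g)"
    unfolding hilbert_subset_def using n by blast
  then obtain t where t: "t \<in> hilbert_set (Suc k) n (G (Suc k) ` Ps) g"
    using K unfolding totally_hilbertian_def by (metis equals0I le_add1 plus_1_eq_Suc)
  have "irreducible_in (polys n) (poly P (value_at t))" if "P \<in> Ps" for P
  proof -
    have P: "P \<in> polys_y n" using Ps(3)[OF that] by (simp add: irreducible_in_def)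
    show ?thesis
      using irreducible_of_spec[OF s poly_value_at_in_polys[OF P]] hilbert_set_G[OF t _ that P]
        spec_F[OF P, of "Suc k" t] by simp
  qed
  then show ?thesis using t by (auto simp: hilbert_set_def)
qed

text \<open>The exponent bound is demanded for every \<open>t\<close>, because \<open>B\<close>
  enters the shifts and thereby the Hilbert set from which \<open>t\<close> is then taken. The
  coordinates of \<open>t\<close> beyond \<open>k\<close> provide the line on which
  \<open>P(x, M)\<close> is known to be irreducible.\<close>

lemma ex_value_at_irreducible_hilbertian:
  assumes s: "\<And>i. s i = (if i = 0 then 0 else mvar (k + n) ^ (B ^ i))"
    and K: "hilbertian TYPE('k)"
    and Ps: "finite Ps" "Ps \<noteq> {}"
      "\<And>P. P \<in> Ps \<Longrightarrow> irreducible_in (polys_y n) P \<and> Polynomial.degree P = 1"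
    and B: "\<And>P t m i. P \<in> Ps \<Longrightarrow> m \<in> Poly_Mapping.keys (poly P (value_at t)) \<Longrightarrow>
      Poly_Mapping.lookup m i < B"
    and g: "g \<in> polys (Suc k)" "g \<noteq> 0"
  shows "\<exists>t. eval_mpoly t g \<noteq> 0 \<and> (\<forall>P \<in> Ps. irreducible_in (polys n) (poly P (value_at t)))"
proof -
  let ?r = "k + n"
  have "hilbert_data ?r 1 (G ?r ` Ps) g"
    using Ps g n by (intro hilbert_data_G) auto
  moreover have "separable_poly (G ?r P)" if "P \<in> Ps" for P
    unfolding G_def using Ps(3)[OF that]
    by (intro separable_polyI irreducible_F pderiv_F) (auto simp: irreducible_in_def)
  ultimately have "separable_hilbert_subset ?r (hilbert_set ?r 1 (G ?r ` Ps) g)"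
    unfolding separable_hilbert_subset_def by blast
  then obtain t where t: "t \<in> hilbert_set ?r 1 (G ?r ` Ps) g"
    using K n unfolding hilbertian_def by (metis equals0I trans_le_add2)
  have "irreducible_in (polys n) (poly P (value_at t))" if "P \<in> Ps" for P
  proof -
    have P: "P \<in> polys_y n" using Ps(3)[OF that] by (simp add: irreducible_in_def)
    let ?q = "poly P (value_at t)"
    have q: "?q \<in> polys n" using P by (rule poly_value_at_in_polys)
    have "msubst (\<lambda>i. spec ?r t (xv i)) ?q =
      msubst (\<lambda>i. if i = 0 then mvar 0 else mconst (t (?r - i)) + mvar 0 ^ (B ^ i)) ?q"
      using q
    proof (rule msubst_cong)
      fix i assume i: "i \<in> {..<n}"
      show "spec ?r t (xv i) = (if i = 0 then mvar 0 else mconst (t (?r - i)) + mvar 0 ^ (B ^ i))"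
        using i by (auto simp: xv_def s spec_def ring_morphism.zero[OF ring_morphism_msubst]
            ring_morphism.add[OF ring_morphism_msubst] ring_morphism.power[OF ring_morphism_msubst])
    qed
    moreover have "irreducible_in (polys 1) (msubst (\<lambda>i. spec ?r t (xv i)) ?q)"
      using hilbert_set_G[OF t _ that P] spec_F[OF P, of ?r t] n by simp
    ultimately show ?thesis
      using irreducible_in_polys_of_line[OF n q B[OF that]] by simp
  qed
  then show ?thesis using t by (auto simp: hilbert_set_def)
qed

end

theorem mainTheorem8:
  fixes n :: nat and Ps :: "(nat, 'k::field) mpoly poly set" and d :: "nat \<Rightarrow> nat"
  assumes "n \<ge> 1"
    and "finite Ps" and "Ps \<noteq> {}"
    and "\<forall>P \<in> Ps. irreducible_in (polys_y n) P \<and> Polynomial.degree P \<ge> 1"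
    and "\<forall>i < n. d i \<ge> 1"
    and "totally_hilbertian TYPE('k) \<or>
         (hilbertian TYPE('k) \<and> (\<forall>P \<in> Ps. Polynomial.degree P = 1))"
  shows "zariski_dense_in_Pol n d (Irr n Ps)"
  unfolding zariski_dense_in_Pol_def
proof
  assume "\<exists>H. H \<in> mpolys (exponents n d) (UNIV :: 'k set) \<and> H \<noteq> 0 \<and>
    (\<forall>M \<in> Irr n Ps \<inter> Pol n d. eval_mpoly (Poly_Mapping.lookup M) H = 0)"
  then obtain H :: "(nat \<Rightarrow>\<^sub>0 nat, 'k) mpoly" where H: "H \<in> mpolys (exponents n d) UNIV" "H \<noteq> 0"
    "\<And>M. M \<in> Irr n Ps \<Longrightarrow> M \<in> Pol n d \<Longrightarrow> eval_mpoly (Poly_Mapping.lookup M) H = 0" by blast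
  define E where "E = exponents n d"
  define k where "k = card (E - {0})"
  \<comment> \<open>The monomial x_0 lies in \<open>E\<close> because \<open>d 0\<close> is
    positive.\<close>
  have E: "finite E" "0 \<in> E" "Poly_Mapping.single 0 1 \<in> E" "\<And>m. m \<in> E \<Longrightarrow> Poly_Mapping.keys m \<subseteq> {..<n}"
    using assms(1,5) finite_exponents by (auto simp: E_def exponents_def lookup_single when_def)
  obtain h where h: "bij_betw h (E - {0}) {..<k}"
    using ex_bij_betw_finite_nat[of "E - {0}"] E(1) by (auto simp: k_def lessThan_atLeast0)
  \<comment> \<open>The constant monomial gets the last number \<open>k\<close>, the place of the
    coefficient that \<open>\<Theta>\<close> shears.\<close>
  define idx where "idx m = (if m = 0 then k else h m)" for m
  have "bij_betw idx (E - {0}) {..<k}"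
    using h by (rule bij_betw_cong[THEN iffD1, rotated]) (auto simp: idx_def)
  then have "bij_betw idx (E - {0} \<union> {0}) ({..<k} \<union> {idx 0})"
    by (intro notIn_Un_bij_betw) (auto simp: idx_def)
  moreover have "E - {0} \<union> {0} = E" "{..<k} \<union> {idx 0} = {..k}"
    using E(2) by (auto simp: idx_def)
  ultimately have idx: "bij_betw idx E {..k}" "idx 0 = k" by (simp_all add: idx_def)
  have gen: "generic_value n k E idx s"
    if "s 0 = 0" "\<And>i. s i \<in> mpolys {k + n} (UNIV :: 'k set)" for s
    by unfold_locales (use assms(1) E idx that in auto)
  \<comment> \<open>The two situations differ only in the shifts \<open>s\<close>, on which
    \<open>value_at\<close> does not depend, so they share this conclusion.\<close>
  have finish: False
    if gv: "generic_value n k E idx s" "\<And>i. s i \<in> mpolys {k + n} (UNIV :: 'k set)"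
      and ex: "\<And>g. g \<in> polys (Suc k) \<Longrightarrow> g \<noteq> 0 \<Longrightarrow> \<exists>t. eval_mpoly t g \<noteq> 0 \<and>
        (\<forall>P \<in> Ps. irreducible_in (polys n) (poly P (generic_value.value_at E idx t)))"
    for s
  proof -
    interpret generic_value n k E idx s by (fact gv)
    obtain t where t: "\<forall>P \<in> Ps. irreducible_in (polys n) (poly P (value_at t))"
      "eval_mpoly (Poly_Mapping.lookup (value_at t)) H \<noteq> 0"
      using ex_value_at[OF H(1)[folded E_def] H(2) ex] by blast
    have "deg_in i (value_at t) \<le> d i" if "i < n" for i
      using keys_value_at[of t] that
      unfolding deg_in_def by (intro Max.boundedI) (auto simp: E_def exponents_def)
    then have "value_at t \<in> Pol n d" by (simp add: Pol_def value_at_in_polys)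
    then show False using H(3) t by (auto simp: Irr_def value_at_in_polys)
  qed
  from assms(6) show False
  proof
    assume K: "totally_hilbertian TYPE('k)"
    interpret generic_value n k E idx "\<lambda>_. 0 :: (nat, 'k) mpoly"
      by (rule gen) (simp_all add: subring_zero[OF subring_mpolys[OF subring_UNIV]])
    show False
      by (rule finish[OF generic_value_axioms s_in])
        (use ex_value_at_irreducible_totally_hilbertian[OF refl K assms(2,3)] assms(4) in blast)
  next
    assume K: "hilbertian TYPE('k) \<and> (\<forall>P \<in> Ps. Polynomial.degree P = 1)"
    obtain b where b: "\<And>P i m v. P \<in> Ps \<Longrightarrow> i \<le> 1 \<Longrightarrow> m \<in> Poly_Mapping.keys (poly.coeff P i) \<Longrightarrow>
      Poly_Mapping.lookup m v \<le> b"
    proof -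
      have "finite (\<Union>P \<in> Ps. \<Union>i \<in> {..1}. Poly_Mapping.keys (poly.coeff P i))"
        using assms(2) by auto
      from ex_exponent_bound[OF this] show thesis using that by blast
    qed
    obtain b' where b': "\<And>m v. m \<in> E \<Longrightarrow> Poly_Mapping.lookup m v \<le> b'"
      using ex_exponent_bound[OF E(1)] by blast
    \<comment> \<open>For \<open>P = [:A, C:]\<close> the exponents in \<open>A + M * C\<close> are
      at most \<open>b + b'\<close>, where \<open>b'\<close> bounds those of M whatever its
      coefficients are; the base must be strictly larger.\<close>
    define B where "B = Suc (b + b')"
    define s :: "nat \<Rightarrow> (nat, 'k) mpoly" where "s i = (if i = 0 then 0 else mvar (k + n) ^ (B ^ i))" for i
    have s_in: "s i \<in> mpolys {k + n} UNIV" for i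
      using subring_mpolys[OF subring_UNIV] by (auto simp: s_def intro: subring_zero subring_power mvar_in_mpolys)
    interpret generic_value n k E idx s
      by (rule gen) (simp_all add: s_in, simp add: s_def)
    have bound: "Poly_Mapping.lookup m i < B"
      if P: "P \<in> Ps" and m: "m \<in> Poly_Mapping.keys (poly P (value_at t))" for P t m i
    proof -
      obtain A C where AC: "P = [:A, C:]" using degree_eq_1E K P by blast
      have "m \<in> Poly_Mapping.keys A \<union> Poly_Mapping.keys (value_at t * C)"
        using m Poly_Mapping.keys_add[of A "value_at t * C"] by (auto simp: AC)
      then consider "m \<in> Poly_Mapping.keys A"
        | m1 m2 where "m = m1 + m2" "m1 \<in> Poly_Mapping.keys (value_at t)" "m2 \<in> Poly_Mapping.keys C"
        using Poly_Mapping.keys_mult[of "value_at t" C] by blast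
      then show ?thesis
      proof cases
        case 1
        then show ?thesis using b[OF P, of 0 m i] by (simp add: AC B_def)
      next
        case 2
        then have "Poly_Mapping.lookup m1 i \<le> b'" "Poly_Mapping.lookup m2 i \<le> b"
          using b[OF P, of 1 m2 i] b'[of m1 i] keys_value_at by (auto simp: AC)
        then show ?thesis using 2 by (simp add: lookup_add B_def)
      qed
    qed
    have ex: "\<exists>t. eval_mpoly t g \<noteq> 0 \<and> (\<forall>P \<in> Ps. irreducible_in (polys n) (poly P (value_at t)))"
      if "g \<in> polys (Suc k)" "g \<noteq> 0" for g
      by (rule ex_value_at_irreducible_hilbertian[OF s_def _ assms(2,3) _ bound that])
        (use K assms(4) in auto)
    show False by (rule finish[OF generic_value_axioms s_in ex])
  qed
qed

end
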